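(* For any infinite Tychonoff space $X$, there are a pseudocompact Ascoli space $Y$ and a $C^\ast$-embedding $T$ from $X$ into $Y$ such that (i) $Y$ is not a $k_{\mathbb{R}}$-space; (ii) $w(Y)= \max\{w(\beta X), \aleph_2\}$; (iii) $T(X)$ is a closed subspace of $Y$; (iv) if, in addition, $X$ is $\omega$-bounded (respectively, sequentially compact, totally countably compact, near sequentially compact, or countably compact), then so is $Y$.
   Context: All spaces are assumed to be Tychonoff. $w(Z)$ denotes the weight of a space $Z$ and $\beta X$ the Stone–Čech compactification of $X$. A $C^\ast$-embedding $T:X\to Y$ is a homeomorphic embedding such that every bounded continuous real-valued function on $T(X)$ extends to a continuous real-valued function on $Y$. A space is pseudocompact if every continuous real-valued function on it is bounded. $C_k(Y)$ denotes the space of all continuous real-valued functions on $Y$ with the compact-open topology; $Y$ is Ascoli if for every compact $\mathcal{K}\subseteq C_k(Y)$ the map $Y\times\mathcal{K}\ni(y,f)\mapsto f(y)$ is continuous. A function $f:Y\to\mathbb{R}$ is $k$-continuous if its restriction to every compact subset of $Y$ is continuous; $Y$ is a $k_{\mathbb{R}}$-space if every $k$-continuous $f:Y\to\mathbb{R}$ is continuous. A space $Z$ is: sequentially compact if every sequence in $Z$ has a convergent subsequence; $\omega$-bounded if every sequence in $Z$ has compact closure; totally countably compact if every sequence in $Z$ has a subsequence with compact closure; near sequentially compact if for any sequence $(U_n)_{n\in\omega}$ of nonempty open sets in $Z$ there exists a sequence $(x_n)_{n\in\omega}\in\prod_{n\in\omega}U_n$ containing a convergent subsequence; countably compact if every sequence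 in $Z$ has a cluster point. *)

theory Defs
  imports "HOL-Analysis.Analysis"
begin

unbundle cardinal_syntax

definition tychonoff_space :: "'a topology \<Rightarrow> bool" where
  "tychonoff_space X \<longleftrightarrow> completely_regular_space X \<and> Hausdorff_space X"

text \<open>The base property is phrased as in the library's characterisation of
  \<^const>\<open>second_countable\<close>: the open sets are exactly the unions of members of the base.\<close>

definition base_of :: "'a topology \<Rightarrow> 'a set set \<Rightarrow> bool" where
  "base_of X \<B> \<longleftrightarrow> openin X = arbitrary union_of (\<lambda>U. U \<in> \<B>)"

text \<open>The weight is the least cardinality of a base, as a cardinal-order relation; it is
  determined up to \<open>=o\<close>.\<close>

definition weight :: "'a topology \<Rightarrow> 'a set rel" where
  "weight X = |SOME \<B>. base_of X \<B> \<and> (\<forall>\<C>. base_of X \<C> \<longrightarrow> |\<B>| \<le>o |\<C>| )|"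

lemma weight_least:
  shows "\<exists>\<B>. base_of X \<B> \<and> weight X = |\<B>|"
    and "base_of X \<C> \<Longrightarrow> weight X \<le>o |\<C>|"
proof -
  define R where "R = card_of ` {\<B>. base_of X \<B>}"
  have "base_of X {U. openin X U}"
    unfolding base_of_def openin_topology_base_unique by (simp, blast)
  then have "R \<noteq> {}"
    by (auto simp: R_def)
  moreover have "\<forall>r\<in>R. Card_order r"
    by (auto simp only: R_def card_of_Card_order)
  ultimately have "\<exists>r\<in>R. \<forall>r'\<in>R. r \<le>o r'"
    by (rule exists_minim_Card_order)
  then obtain r where r: "r \<in> R" "\<forall>r'\<in>R. r \<le>o r'" ..
  from r(1) obtain \<B> where \<B>: "base_of X \<B>" "r = |\<B>|"
    by (auto simp: R_def)
  then have ex: "\<exists>\<B>. base_of X \<B> \<and> (\<forall>\<C>. base_of X \<C> \<longrightarrow> |\<B>| \<le>o |\<C>| )"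
    using r(2) by (intro exI[of _ \<B>]) (simp add: R_def)
  note least = someI_ex[OF ex]
  show "\<exists>\<B>. base_of X \<B> \<and> weight X = |\<B>|"
    unfolding weight_def by (rule exI, rule conjI, rule conjunct1[OF least], rule refl)
  show "weight X \<le>o |\<C>|" if "base_of X \<C>"
    unfolding weight_def using conjunct2[OF least] that by simp
qed

definition aleph2 :: "nat set set rel" where
  "aleph2 = cardSuc (cardSuc natLeq)"

text \<open>\<open>t = max {r, s}\<close> for cardinals living on possibly different types, where equality and
  order of cardinals are \<open>=o\<close> and \<open>\<le>o\<close>.\<close>

definition is_max_card :: "'c rel \<Rightarrow> 'a rel \<Rightarrow> 'b rel \<Rightarrow> bool" where
  "is_max_card t r s \<longleftrightarrow> r \<le>o t \<and> s \<le>o t \<and> (t =o r \<or> t =o s)"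

text \<open>The Stone--\v{C}ech compactification: the closure of the image of \<open>X\<close> under evaluation in
  the cube with one factor \<open>[0,1]\<close> for each continuous \<open>X \<rightarrow> [0,1]\<close>.  Functions on the carrier are
  represented by their extensional representatives.\<close>

definition unit_functions :: "'a topology \<Rightarrow> ('a \<Rightarrow> real) set" where
  "unit_functions X =
     {f \<in> extensional (topspace X). continuous_map X (top_of_set {0..1}) f}"

definition stone_cech_cube :: "'a topology \<Rightarrow> (('a \<Rightarrow> real) \<Rightarrow> real) topology" where
  "stone_cech_cube X = product_topology (\<lambda>f. top_of_set {0..1}) (unit_functions X)"

definition stone_cech :: "'a topology \<Rightarrow> (('a \<Rightarrow> real) \<Rightarrow> real) topology" where
  "stone_cech X = subtopology (stone_cech_cube X)
     (stone_cech_cube X closure_of ((\<lambda>x. \<lambda>f\<in>unit_functions X. f x) ` topspace X))"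

definition C_star_embedding :: "'a topology \<Rightarrow> 'b topology \<Rightarrow> ('a \<Rightarrow> 'b) \<Rightarrow> bool" where
  "C_star_embedding X Y T \<longleftrightarrow>
     embedding_map X Y T \<and>
     (\<forall>f. continuous_map (subtopology Y (T ` topspace X)) euclideanreal f \<and>
          bounded (f ` (T ` topspace X)) \<longrightarrow>
          (\<exists>g. continuous_map Y euclideanreal g \<and> (\<forall>y \<in> T ` topspace X. g y = f y)))"

definition pseudocompact_space :: "'a topology \<Rightarrow> bool" where
  "pseudocompact_space X \<longleftrightarrow>
     (\<forall>f. continuous_map X euclideanreal f \<longrightarrow> bounded (f ` topspace X))"

text \<open>\<open>C\<^sub>k(X)\<close>, generated by the sets \<open>{f. f(K) \<subseteq> U}\<close> with \<open>K\<close> compact and \<open>U\<close> open; the case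
  \<open>K = {}\<close> makes the whole function set the carrier.\<close>

definition continuous_functions :: "'a topology \<Rightarrow> ('a \<Rightarrow> real) set" where
  "continuous_functions X = {f \<in> extensional (topspace X). continuous_map X euclideanreal f}"

definition compact_open_topology :: "'a topology \<Rightarrow> ('a \<Rightarrow> real) topology" where
  "compact_open_topology X = topology_generated_by
     {{f \<in> continuous_functions X. f ` K \<subseteq> U} | K U. compactin X K \<and> open U}"

definition ascoli_space :: "'a topology \<Rightarrow> bool" where
  "ascoli_space X \<longleftrightarrow>
     (\<forall>\<K>. compactin (compact_open_topology X) \<K> \<longrightarrow>
        continuous_map (prod_topology X (subtopology (compact_open_topology X) \<K>))
          euclideanreal (\<lambda>(x, f). f x))"

definition k_continuous :: "'a topology \<Rightarrow> ('a \<Rightarrow> real) \<Rightarrow> bool" where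
  "k_continuous X f \<longleftrightarrow>
     (\<forall>K. compactin X K \<longrightarrow> continuous_map (subtopology X K) euclideanreal f)"

definition kR_space :: "'a topology \<Rightarrow> bool" where
  "kR_space X \<longleftrightarrow> (\<forall>f. k_continuous X f \<longrightarrow> continuous_map X euclideanreal f)"

definition has_convergent_subseq :: "'a topology \<Rightarrow> (nat \<Rightarrow> 'a) \<Rightarrow> bool" where
  "has_convergent_subseq X \<sigma> \<longleftrightarrow>
     (\<exists>r l. strict_mono (r :: nat \<Rightarrow> nat) \<and> limitin X (\<sigma> \<circ> r) l sequentially)"

definition sequentially_compact_space :: "'a topology \<Rightarrow> bool" where
  "sequentially_compact_space X \<longleftrightarrow>
     (\<forall>\<sigma>. range \<sigma> \<subseteq> topspace X \<longrightarrow> has_convergent_subseq X \<sigma>)"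

definition omega_bounded_space :: "'a topology \<Rightarrow> bool" where
  "omega_bounded_space X \<longleftrightarrow>
     (\<forall>\<sigma> :: nat \<Rightarrow> 'a. range \<sigma> \<subseteq> topspace X \<longrightarrow> compactin X (X closure_of range \<sigma>))"

definition totally_countably_compact_space :: "'a topology \<Rightarrow> bool" where
  "totally_countably_compact_space X \<longleftrightarrow>
     (\<forall>\<sigma> :: nat \<Rightarrow> 'a. range \<sigma> \<subseteq> topspace X \<longrightarrow>
        (\<exists>r :: nat \<Rightarrow> nat. strict_mono r \<and> compactin X (X closure_of range (\<sigma> \<circ> r))))"

definition near_sequentially_compact_space :: "'a topology \<Rightarrow> bool" where
  "near_sequentially_compact_space X \<longleftrightarrow>
     (\<forall>U :: nat \<Rightarrow> 'a set. (\<forall>n. openin X (U n) \<and> U n \<noteq> {}) \<longrightarrow>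
        (\<exists>\<sigma>. (\<forall>n. \<sigma> n \<in> U n) \<and> has_convergent_subseq X \<sigma>))"

definition countably_compact_space :: "'a topology \<Rightarrow> bool" where
  "countably_compact_space X \<longleftrightarrow>
     (\<forall>\<sigma> :: nat \<Rightarrow> 'a. range \<sigma> \<subseteq> topspace X \<longrightarrow>
        (\<exists>x \<in> topspace X. \<forall>U. openin X U \<and> x \<in> U \<longrightarrow> infinite {n. \<sigma> n \<in> U}))"

text \<open>Quantification over all spaces \<open>Y\<close> needs a type for their points.  For infinite Tychonoff
  \<open>X\<close> on type \<open>'a\<close> the weight of \<open>\<beta>X\<close> is at most \<open>2^|X|\<close>, and \<open>\<aleph>\<^sub>2 \<le> 2^2^|X|\<close>, so a Tychonoff space of
  weight \<open>max {w(\<beta>X), \<aleph>\<^sub>2}\<close> embeds in a Tychonoff cube of cardinality at most \<open>2^2^2^|X|\<close>.  Hence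
  every candidate \<open>Y\<close> has a homeomorphic copy on the following type.\<close>

type_synonym 'a candidate_point = "'a set set set"

end

theory Submission
  imports Defs "HOL-Algebra.Free_Abelian_Groups" "HOL-Library.Countable_Set_Type"
begin

text \<open>
  Let \<open>\<kappa>\<close> be the weight of \<open>\<beta>X\<close> and \<open>I\<close> a set of \<open>max {\<kappa>, \<aleph>\<^sub>2}\<close> coordinates, \<open>\<aleph>\<^sub>2\<close> of which form the set
  \<open>L\<close>. Embed \<open>\<beta>X\<close> into the cube \<open>[0,1]\<^sup>I\<close> by separating functions on the coordinates outside \<open>L\<close> and by
  the constant \<open>1\<close> on \<open>L\<close>. The space \<open>Y\<close> is the union of the \<open>\<Sigma>\<close>-product in \<open>[0,1]\<^sup>I\<close> and of the image \<open>E\<close>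
  of \<open>X\<close>.

  The \<open>\<Sigma>\<close>-product is dense, sequentially compact and \<open>\<omega>\<close>-bounded, so \<open>Y\<close> is pseudocompact and inherits
  the compactness properties of \<open>X\<close>; bounded functions on \<open>X\<close> extend over \<open>\<beta>X\<close> and then, by Tietze, over
  the cube. Pairs of points of the \<open>\<Sigma>\<close>-product that can be found in every neighbourhood of a point of
  \<open>Y\<close> contain two sequences with a common limit in the \<open>\<Sigma>\<close>-product, which makes compact subsets of
  \<open>C\<^sub>k(Y)\<close> equicontinuous. Finally, a compact subset of \<open>Y\<close> whose trace on the \<open>\<Sigma>\<close>-product accumulates at
  a point of \<open>E\<close> would contain points with support of cardinality \<open>\<aleph>\<^sub>1\<close> within \<open>L\<close>, which do not lie in
  \<open>Y\<close>; hence the indicator of \<open>E\<close> is \<open>k\<close>-continuous but not continuous.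
\<close>

section \<open>Spaces with a dense sequential core\<close>

lemma topspace_compact_open_topology:
  "topspace (compact_open_topology X) = continuous_functions X"
proof -
  have "continuous_functions X \<in> {{f \<in> continuous_functions X. f ` K \<subseteq> U} | K U. compactin X K \<and> open U}"
    by (rule CollectI, rule exI[of _ "{}"], rule exI[of _ UNIV]) auto
  then show ?thesis
    unfolding compact_open_topology_def topology_generated_by_topspace by blast
qed

lemma openin_compact_open_topology_basic:
  assumes "compactin X K" "open U"
  shows "openin (compact_open_topology X) {f \<in> continuous_functions X. f ` K \<subseteq> U}"
  unfolding compact_open_topology_def
  by (rule topology_generated_by_Basis) (use assms in blast)

lemma continuous_map_real_iff:
  "continuous_map X euclideanreal f \<longleftrightarrow>
    (\<forall>x\<in>topspace X. \<forall>\<epsilon>>0. \<exists>U. openin X U \<and> x \<in> U \<and> (\<forall>y\<in>U. \<bar>f y - f x\<bar> < \<epsilon>))"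
  using Met_TC.continuous_map_to_metric[of X f]
  by (simp add: dist_real_def abs_minus_commute)

lemma limitin_eventually_dist:
  fixes f :: "'a \<Rightarrow> real"
  assumes "continuous_map X euclideanreal f" "limitin X \<sigma> l sequentially" "\<epsilon> > 0"
  shows "\<forall>\<^sub>F n in sequentially. \<bar>f (\<sigma> n) - f l\<bar> < \<epsilon>"
proof -
  have "limitin euclideanreal (f \<circ> \<sigma>) (f l) sequentially"
    by (rule continuous_map_limit[OF assms(1,2)])
  then have "((f \<circ> \<sigma>) \<longlongrightarrow> f l) sequentially"
    by (simp add: limitin_canonical_iff)
  from tendstoD[OF this assms(3)] show ?thesis
    by (simp add: dist_real_def)
qed

lemma has_convergent_subseq_image:
  assumes "continuous_map X Y T" "has_convergent_subseq X \<sigma>"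
  shows "has_convergent_subseq Y (T \<circ> \<sigma>)"
  using assms(2) continuous_map_limit[OF assms(1)] unfolding has_convergent_subseq_def
  by (auto simp: comp_assoc) blast

lemma has_convergent_subseq_subseq:
  assumes "strict_mono (r :: nat \<Rightarrow> nat)" "has_convergent_subseq X (\<sigma> \<circ> r)"
  shows "has_convergent_subseq X \<sigma>"
  using assms(2) strict_mono_o[OF assms(1)] unfolding has_convergent_subseq_def
  by (auto simp: comp_assoc)

lemma compactin_closure_of_subset:
  assumes "Hausdorff_space X" "compactin X C" "S \<subseteq> C"
  shows "compactin X (X closure_of S)"
proof (rule closed_compactin[OF assms(2)])
  show "X closure_of S \<subseteq> C"
    by (rule closure_of_minimal[OF assms(3) compactin_imp_closedin[OF assms(1,2)]])
qed simp

lemma subseq_in_union: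
  fixes \<sigma> :: "nat \<Rightarrow> 'a"
  assumes "range \<sigma> \<subseteq> A \<union> B"
  obtains r :: "nat \<Rightarrow> nat" where "strict_mono r" "range (\<sigma> \<circ> r) \<subseteq> A \<or> range (\<sigma> \<circ> r) \<subseteq> B"
proof -
  have "infinite {n. \<sigma> n \<in> A} \<or> infinite {n. \<sigma> n \<in> B}"
  proof (rule ccontr)
    assume "\<not> ?thesis"
    then have "finite ({n. \<sigma> n \<in> A} \<union> {n. \<sigma> n \<in> B})" by simp
    moreover have "{n. \<sigma> n \<in> A} \<union> {n. \<sigma> n \<in> B} = UNIV" using assms by auto
    ultimately show False by simp
  qed
  then show thesis
  proof
    assume "infinite {n. \<sigma> n \<in> A}"
    then obtain r :: "nat \<Rightarrow> nat" where "strict_mono r" "\<And>n. r n \<in> {n. \<sigma> n \<in> A}"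
      using infinite_enumerate by blast
    then show thesis by (intro that[of r]) auto
  next
    assume "infinite {n. \<sigma> n \<in> B}"
    then obtain r :: "nat \<Rightarrow> nat" where "strict_mono r" "\<And>n. r n \<in> {n. \<sigma> n \<in> B}"
      using infinite_enumerate by blast
    then show thesis by (intro that[of r]) auto
  qed
qed

text \<open>The properties of the \<Sigma>-product that the topological conclusions rest on,
  isolated so that they can be transported to a homeomorphic copy. \<open>paired_sequences\<close>
  stands in for first countability: the common limit \<open>l\<close> may differ from
  \<open>q\<close>.\<close>

locale sequential_core =
  fixes Y :: "'a topology" and D :: "'a set"
  assumes dense: "Y closure_of D = topspace Y"
    and core_subset: "D \<subseteq> topspace Y"
    and convergent_subsequence:
      "range (\<sigma> :: nat \<Rightarrow> 'a) \<subseteq> D \<Longrightarrow>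
        \<exists>l \<in> D. \<exists>r :: nat \<Rightarrow> nat. strict_mono r \<and> limitin Y (\<sigma> \<circ> r) l sequentially"
    and countable_compact_hull:
      "countable A \<Longrightarrow> A \<subseteq> D \<Longrightarrow> \<exists>C. compactin Y C \<and> C \<subseteq> D \<and> A \<subseteq> C"
    and paired_sequences:
      "\<lbrakk>q \<in> topspace Y; R \<subseteq> D \<times> D;
        \<forall>W. openin Y W \<and> q \<in> W \<longrightarrow> R \<inter> W \<times> W \<noteq> {}\<rbrakk>
       \<Longrightarrow> \<exists>u v l. (\<forall>n :: nat. (u n, v n) \<in> R) \<and>
             limitin Y u l sequentially \<and> limitin Y v l sequentially"
begin

lemma meets_open: "openin Y W \<Longrightarrow> W \<noteq> {} \<Longrightarrow> \<exists>p \<in> D. p \<in> W"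
  using dense unfolding dense_intersects_open by blast

lemma pseudocompact: "pseudocompact_space Y"
  unfolding pseudocompact_space_def
proof (intro allI impI, rule ccontr)
  fix f assume f: "continuous_map Y euclideanreal f" and unb: "\<not> bounded (f ` topspace Y)"
  have "\<exists>p\<in>D. \<bar>f p\<bar> > real n" for n
  proof -
    obtain y where y: "y \<in> topspace Y" "\<bar>f y\<bar> > real n"
      using unb unfolding bounded_iff by (auto simp: not_le)
    \<comment> \<open>The set where \<open>\<bar>f\<bar>\<close> exceeds \<open>n\<close> is open
      and nonempty, so density moves the unboundedness of \<open>f\<close> into the core.\<close>
    have "openin Y {x \<in> topspace Y. f x \<in> {z. \<bar>z\<bar> > real n}}"
      by (rule openin_continuous_map_preimage[OF f])
        (auto intro!: open_Collect_less continuous_intros)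
    from meets_open[OF this] show ?thesis using y by auto
  qed
  then obtain \<sigma> where \<sigma>: "\<And>n. \<sigma> n \<in> D" "\<And>n. \<bar>f (\<sigma> n)\<bar> > real n" by metis
  obtain l r where r: "strict_mono r" and l: "limitin Y (\<sigma> \<circ> r) l sequentially"
    using convergent_subsequence[of \<sigma>] \<sigma>(1) by blast
  have "\<forall>\<^sub>F n in sequentially. \<bar>f ((\<sigma> \<circ> r) n) - f l\<bar> < 1"
    by (rule limitin_eventually_dist[OF f l]) simp
  moreover have "\<forall>\<^sub>F n in sequentially. real n > \<bar>f l\<bar> + 1"
    by (rule eventually_compose_filterlim[OF eventually_gt_at_top filterlim_real_sequentially])
  ultimately have "\<forall>\<^sub>F n in sequentially. False"
  proof eventually_elim
    case (elim n)
    \<comment> \<open>A subsequence index dominates its position, so the values at the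
      \<open>r n\<close> still outgrow every bound, while continuity keeps them within
      \<open>1\<close> of \<open>f l\<close>.\<close>
    have "real n \<le> real (r n)" using seq_suble[OF r] by simp
    then show ?case using elim \<sigma>(2)[of "r n"] by simp
  qed
  then show False by simp
qed

text \<open>A compact family in \<open>C\<^sub>k(Y)\<close> cannot oscillate by \<open>\<epsilon>\<close> along two sequences with a common limit, since
  these sequences lie in a compact set; hence it is equicontinuous at every point.\<close>

lemma compact_family_equicontinuous:
  assumes K: "compactin (compact_open_topology Y) \<K>" and q: "q \<in> topspace Y" and "\<epsilon> > 0"
  obtains W where "openin Y W" "q \<in> W" "\<And>f p. f \<in> \<K> \<Longrightarrow> p \<in> W \<Longrightarrow> \<bar>f p - f q\<bar> \<le> 3 * \<epsilon>"
proof -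
  have Kcont: "continuous_map Y euclideanreal f" if "f \<in> \<K>" for f
    using compactin_subset_topspace[OF K] that
    by (auto simp: topspace_compact_open_topology continuous_functions_def)
  \<comment> \<open>The bad pairs of core points. A neighbourhood of \<open>q\<close> without bad
    pairs bounds the oscillation of all members of \<open>\<K>\<close> on its core points at
    once.\<close>
  define R where "R = {(p, p'). p \<in> D \<and> p' \<in> D \<and> (\<exists>f\<in>\<K>. \<bar>f p - f p'\<bar> > \<epsilon>)}"
  have "\<exists>W. openin Y W \<and> q \<in> W \<and> R \<inter> W \<times> W = {}"
  proof (rule ccontr)
    assume "\<not> ?thesis"
    then obtain u v l where R: "\<And>n :: nat. (u n, v n) \<in> R"
      and ul: "limitin Y u l sequentially" and vl: "limitin Y v l sequentially"
    proof -
      have "R \<subseteq> D \<times> D" by (auto simp: R_def)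
      moreover have "\<forall>W. openin Y W \<and> q \<in> W \<longrightarrow> R \<inter> W \<times> W \<noteq> {}"
        using \<open>\<not> (\<exists>W. openin Y W \<and> q \<in> W \<and> R \<inter> W \<times> W = {})\<close> by blast
      ultimately show thesis using paired_sequences[OF q] that by metis
    qed
    then have uD: "\<And>n. u n \<in> D" "\<And>n. v n \<in> D" by (auto simp: R_def)
    from R have "\<exists>f\<in>\<K>. \<bar>f (u n) - f (v n)\<bar> > \<epsilon>" for n by (auto simp: R_def)
    then obtain F where F: "\<And>n. F n \<in> \<K>" "\<And>n. \<bar>F n (u n) - F n (v n)\<bar> > \<epsilon>" by metis
    \<comment> \<open>The tails of \<open>u\<close> and \<open>v\<close> together with
      \<open>l\<close> form a compact set \<open>C\<close>. Mapping \<open>C\<close> into the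
      \<open>\<epsilon>/2\<close>-interval around \<open>f l\<close> is a subbasic condition, and it
      keeps the values at \<open>u n\<close> and \<open>v n\<close> within \<open>\<epsilon>\<close>
      of each other.\<close>
    have "\<exists>O' N. openin (compact_open_topology Y) O' \<and> f \<in> O' \<and>
             (\<forall>g\<in>O'. \<forall>n\<ge>N. \<bar>g (u n) - g (v n)\<bar> < \<epsilon>)" if f: "f \<in> \<K>" for f
    proof -
      have "\<forall>\<^sub>F n in sequentially. \<bar>f (u n) - f l\<bar> < \<epsilon>/2 \<and> \<bar>f (v n) - f l\<bar> < \<epsilon>/2"
        using limitin_eventually_dist[OF Kcont[OF f] ul, of "\<epsilon>/2"]
          limitin_eventually_dist[OF Kcont[OF f] vl, of "\<epsilon>/2"] \<open>\<epsilon> > 0\<close>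
        by (auto intro: eventually_conj)
      then obtain N where N: "\<And>n. n \<ge> N \<Longrightarrow> \<bar>f (u n) - f l\<bar> < \<epsilon>/2 \<and> \<bar>f (v n) - f l\<bar> < \<epsilon>/2"
        unfolding eventually_sequentially by blast
      define C where "C = insert l (u ` {N..}) \<union> insert l (v ` {N..})"
      have "compactin Y (insert l (u ` {N..}))"
        by (rule compactin_sequence_with_limit[OF ul]) (use uD core_subset in auto)
      moreover have "compactin Y (insert l (v ` {N..}))"
        by (rule compactin_sequence_with_limit[OF vl]) (use uD core_subset in auto)
      ultimately have C: "compactin Y C" unfolding C_def by (rule compactin_Un)
      define O' where "O' = {g \<in> continuous_functions Y. g ` C \<subseteq> {f l - \<epsilon>/2 <..< f l + \<epsilon>/2}}"
      have "openin (compact_open_topology Y) O'"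
        unfolding O'_def by (rule openin_compact_open_topology_basic[OF C]) simp
      moreover have "f \<in> O'"
      proof -
        have "f \<in> continuous_functions Y"
          using compactin_subset_topspace[OF K] f by (auto simp: topspace_compact_open_topology)
        moreover have "f ` C \<subseteq> {f l - \<epsilon>/2 <..< f l + \<epsilon>/2}"
        proof -
          have "f x \<in> {f l - \<epsilon>/2 <..< f l + \<epsilon>/2}" if "\<bar>f x - f l\<bar> < \<epsilon>/2" for x
            using that unfolding greaterThanLessThan_iff by linarith
          moreover have "\<bar>f x - f l\<bar> < \<epsilon>/2" if "x \<in> C" for x
            using that N \<open>\<epsilon> > 0\<close> unfolding C_def by auto
          ultimately show ?thesis by blast
        qed
        ultimately show ?thesis by (simp add: O'_def)
      qed
      moreover have "\<bar>g (u n) - g (v n)\<bar> < \<epsilon>" if "g \<in> O'" "n \<ge> N" for g n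
      proof -
        have "u n \<in> C" "v n \<in> C" using that(2) by (auto simp: C_def)
        then have "g (u n) \<in> {f l - \<epsilon>/2 <..< f l + \<epsilon>/2}" "g (v n) \<in> {f l - \<epsilon>/2 <..< f l + \<epsilon>/2}"
          using that(1) unfolding O'_def by blast+
        then show ?thesis by (auto simp: abs_less_iff)
      qed
      ultimately show ?thesis by blast
    qed
    then obtain V N where V: "\<And>f. f \<in> \<K> \<Longrightarrow> openin (compact_open_topology Y) (V f) \<and> f \<in> V f"
      and VN: "\<And>f g n. \<lbrakk>f \<in> \<K>; g \<in> V f; n \<ge> N f\<rbrakk> \<Longrightarrow> \<bar>g (u n) - g (v n)\<bar> < \<epsilon>"
      by metis
    have "\<exists>\<F>. finite \<F> \<and> \<F> \<subseteq> V ` \<K> \<and> \<K> \<subseteq> \<Union>\<F>"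
      by (rule compactinD[OF K]) (use V in auto)
    then obtain \<F> where \<F>: "finite \<F>" "\<F> \<subseteq> V ` \<K>" "\<K> \<subseteq> \<Union>\<F>" by blast
    then obtain G where G: "finite G" "G \<subseteq> \<K>" "\<F> = V ` G"
      by (meson finite_subset_image)
    \<comment> \<open>One index beyond the thresholds of a finite subcover; the inserted
      \<open>0\<close> keeps \<open>Max\<close> meaningful for empty \<open>G\<close>. The function
      \<open>F n\<close> lies in a member of the subcover, so it cannot oscillate by more than
      \<open>\<epsilon>\<close> at this index.\<close>
    define n where "n = Max (insert 0 (N ` G))"
    obtain f where f: "f \<in> G" "F n \<in> V f" using \<F>(3) G(3) F(1)[of n] by blast
    have "N f \<le> n" unfolding n_def by (rule Max_ge) (use G f in auto)
    then show False using VN[of f "F n" n] F(2)[of n] f G(2) by fastforce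
  qed
  then obtain W where W: "openin Y W" "q \<in> W" "R \<inter> W \<times> W = {}" by blast
  \<comment> \<open>Density replaces \<open>p\<close> and \<open>q\<close> by core points of
    \<open>W\<close> with nearly the same values. The two replacements and one comparison inside the
    core account for the factor \<open>3\<close>.\<close>
  have near: "\<exists>p'\<in>D \<inter> W. \<bar>f p' - f p\<bar> < \<epsilon>" if "f \<in> \<K>" "p \<in> W" for f p
  proof -
    have "openin Y {x \<in> topspace Y. f x \<in> ball (f p) \<epsilon>}"
      by (rule openin_continuous_map_preimage[OF Kcont[OF that(1)]]) simp
    then have "openin Y (W \<inter> {x \<in> topspace Y. f x \<in> ball (f p) \<epsilon>})" using W(1) by blast
    moreover have "p \<in> W \<inter> {x \<in> topspace Y. f x \<in> ball (f p) \<epsilon>}"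
      using that(2) openin_subset[OF W(1)] \<open>\<epsilon> > 0\<close> by auto
    ultimately obtain p' where "p' \<in> D" "p' \<in> W \<inter> {x \<in> topspace Y. f x \<in> ball (f p) \<epsilon>}"
      using meets_open by blast
    then show ?thesis by (auto simp: dist_real_def abs_minus_commute)
  qed
  show thesis
  proof
    show "openin Y W" "q \<in> W" by fact+
    fix f p assume f: "f \<in> \<K>" and p: "p \<in> W"
    obtain a where a: "a \<in> D \<inter> W" "\<bar>f a - f p\<bar> < \<epsilon>" using near[OF f p] by blast
    obtain b where b: "b \<in> D \<inter> W" "\<bar>f b - f q\<bar> < \<epsilon>" using near[OF f W(2)] by blast
    have "(a, b) \<notin> R" using W(3) a b by blast
    then have "\<bar>f a - f b\<bar> \<le> \<epsilon>" using a b f unfolding R_def by force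
    then show "\<bar>f p - f q\<bar> \<le> 3 * \<epsilon>" using a b by linarith
  qed
qed

text \<open>Equicontinuity controls the change of the point, and the subbasic neighbourhood of
  \<open>f0\<close> belonging to the compact set \<open>{q}\<close> controls the change of the
  function. The error is below \<open>3\<epsilon>/8 + \<epsilon>/2\<close>.\<close>

lemma ascoli: "ascoli_space Y"
  unfolding ascoli_space_def
proof (intro allI impI)
  fix \<K> assume K: "compactin (compact_open_topology Y) \<K>"
  let ?C = "subtopology (compact_open_topology Y) \<K>"
  have sub: "\<K> \<subseteq> continuous_functions Y"
    using compactin_subset_topspace[OF K] by (simp add: topspace_compact_open_topology)
  have top: "topspace ?C = \<K>"
    using sub by (auto simp: topspace_compact_open_topology)
  show "continuous_map (prod_topology Y ?C) euclideanreal (\<lambda>(x, f). f x)"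
    unfolding continuous_map_real_iff
  proof (intro ballI allI impI)
    fix z \<epsilon> assume z: "z \<in> topspace (prod_topology Y ?C)" and \<epsilon>: "(\<epsilon> :: real) > 0"
    obtain q f0 where zq: "z = (q, f0)" "q \<in> topspace Y" "f0 \<in> \<K>"
      using z top by auto
    obtain W where W: "openin Y W" "q \<in> W" "\<And>f p. f \<in> \<K> \<Longrightarrow> p \<in> W \<Longrightarrow> \<bar>f p - f q\<bar> \<le> 3 * (\<epsilon>/8)"
      using compact_family_equicontinuous[OF K zq(2), of "\<epsilon>/8"] \<epsilon> by auto
    define V where "V = {f \<in> continuous_functions Y. f ` {q} \<subseteq> ball (f0 q) (\<epsilon>/2)}"
    have "openin (compact_open_topology Y) V"
      unfolding V_def by (rule openin_compact_open_topology_basic) (use zq in auto)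
    then have "openin ?C (V \<inter> \<K>)" by (auto simp: openin_subtopology)
    then have "openin (prod_topology Y ?C) (W \<times> (V \<inter> \<K>))"
      using W(1) by (simp add: openin_prod_Times_iff)
    moreover have "z \<in> W \<times> (V \<inter> \<K>)" using zq W(2) sub \<epsilon> by (auto simp: V_def)
    moreover have "\<bar>(case y of (x, f) \<Rightarrow> f x) - (case z of (x, f) \<Rightarrow> f x)\<bar> < \<epsilon>"
      if yW: "y \<in> W \<times> (V \<inter> \<K>)" for y
    proof -
      obtain p f where y: "y = (p, f)" "p \<in> W" "f \<in> V" "f \<in> \<K>" using yW by (cases y) auto
      have "\<bar>f p - f q\<bar> \<le> 3 * (\<epsilon>/8)" using W(3) y by blast
      moreover have "\<bar>f0 q - f q\<bar> < \<epsilon>/2" using y(3) by (simp add: V_def dist_real_def)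
      ultimately have "\<bar>f p - f0 q\<bar> < \<epsilon>" using \<epsilon> by linarith
      then show ?thesis by (simp add: y zq)
    qed
    ultimately show "\<exists>U. openin (prod_topology Y ?C) U \<and> z \<in> U \<and>
        (\<forall>y\<in>U. \<bar>(case y of (x, f) \<Rightarrow> f x) - (case z of (x, f) \<Rightarrow> f x)\<bar> < \<epsilon>)"
      by blast
  qed
qed

text \<open>By density the points can be selected in the core, where every sequence has a convergent
  subsequence.\<close>

lemma near_sequentially_compact: "near_sequentially_compact_space Y"
  unfolding near_sequentially_compact_space_def
proof (intro allI impI)
  fix U :: "nat \<Rightarrow> 'a set" assume "\<forall>n. openin Y (U n) \<and> U n \<noteq> {}"
  then have "\<forall>n. \<exists>p\<in>D. p \<in> U n" using meets_open by blast
  then obtain \<sigma> where "\<And>n. \<sigma> n \<in> D" "\<And>n. \<sigma> n \<in> U n" by metis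
  moreover from this have "has_convergent_subseq Y \<sigma>"
    using convergent_subsequence[of \<sigma>] unfolding has_convergent_subseq_def by blast
  ultimately show "\<exists>\<sigma>. (\<forall>n. \<sigma> n \<in> U n) \<and> has_convergent_subseq Y \<sigma>" by blast
qed

section \<open>Compactness properties passing from \<open>X\<close> to \<open>Y\<close>\<close>

context
  fixes X :: "'b topology" and T :: "'b \<Rightarrow> 'a"
  assumes cover: "topspace Y = D \<union> T ` topspace X" and cont: "continuous_map X Y T"
    and Hausdorff: "Hausdorff_space Y"
begin

text \<open>Reduces a sequence in \<open>Y\<close> either to one in the core, settled by the locale
  axioms, or to the image of one in \<open>X\<close>, settled by the assumption on
  \<open>X\<close>.\<close>

lemma split_sequence:
  assumes "range \<sigma> \<subseteq> topspace Y"
  obtains r where "strict_mono (r :: nat \<Rightarrow> nat)" "range (\<sigma> \<circ> r) \<subseteq> D"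
  | r \<xi> where "strict_mono (r :: nat \<Rightarrow> nat)" "range \<xi> \<subseteq> topspace X" "\<sigma> \<circ> r = T \<circ> \<xi>"
proof -
  obtain r where r: "strict_mono (r :: nat \<Rightarrow> nat)"
      "range (\<sigma> \<circ> r) \<subseteq> D \<or> range (\<sigma> \<circ> r) \<subseteq> T ` topspace X"
    using subseq_in_union[of \<sigma> D "T ` topspace X"] assms unfolding cover by blast
  show thesis
  proof (cases "range (\<sigma> \<circ> r) \<subseteq> D")
    case False
    then have "\<forall>n. \<exists>x\<in>topspace X. (\<sigma> \<circ> r) n = T x" using r(2) by blast
    then obtain \<xi> where "\<forall>n. \<xi> n \<in> topspace X \<and> (\<sigma> \<circ> r) n = T (\<xi> n)" by metis
    then show thesis using r(1) that(2)[of r \<xi>] by (auto simp: fun_eq_iff)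
  qed (use that(1) r(1) in blast)
qed

lemma sequentially_compact:
  assumes "sequentially_compact_space X"
  shows "sequentially_compact_space Y"
  unfolding sequentially_compact_space_def
proof (intro allI impI)
  fix \<sigma> :: "nat \<Rightarrow> 'a" assume "range \<sigma> \<subseteq> topspace Y"
  then show "has_convergent_subseq Y \<sigma>"
  proof (cases rule: split_sequence)
    case (1 r)
    then have "has_convergent_subseq Y (\<sigma> \<circ> r)"
      using convergent_subsequence[of "\<sigma> \<circ> r"] unfolding has_convergent_subseq_def by blast
    then show ?thesis by (rule has_convergent_subseq_subseq[OF 1(1)])
  next
    case (2 r \<xi>)
    then have "has_convergent_subseq Y (\<sigma> \<circ> r)"
      using assms has_convergent_subseq_image[OF cont]
      unfolding sequentially_compact_space_def by simp
    then show ?thesis by (rule has_convergent_subseq_subseq[OF 2(1)])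
  qed
qed

text \<open>Here the whole range must be captured, so it is divided rather than thinned out: its
  core part has a compact hull, and the rest lies in the image of a compact closure in
  \<open>X\<close>.\<close>

lemma omega_bounded:
  assumes "omega_bounded_space X"
  shows "omega_bounded_space Y"
  unfolding omega_bounded_space_def
proof (intro allI impI)
  fix \<sigma> :: "nat \<Rightarrow> 'a" assume \<sigma>: "range \<sigma> \<subseteq> topspace Y"
  have "countable (range \<sigma> \<inter> D)" by simp
  then obtain C where C: "compactin Y C" "range \<sigma> \<inter> D \<subseteq> C"
    using countable_compact_hull[of "range \<sigma> \<inter> D"] by blast
  have "\<exists>C'. compactin Y C' \<and> range \<sigma> - D \<subseteq> C'"
  proof (cases "range \<sigma> - D = {}")
    case True
    then show ?thesis by (intro exI[of _ "{}"]) auto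
  next
    case False
    have "\<forall>y\<in>range \<sigma> - D. \<exists>x\<in>topspace X. y = T x" using \<sigma> cover by blast
    then obtain s where s: "\<And>y. y \<in> range \<sigma> - D \<Longrightarrow> s y \<in> topspace X \<and> y = T (s y)" by metis
    \<comment> \<open>Lists the remaining values as a sequence, with repetitions if they are
      finitely many, so that \<omega>-boundedness of \<open>X\<close> applies to chosen
      preimages.\<close>
    define \<tau> where "\<tau> = from_nat_into (range \<sigma> - D)"
    have \<tau>: "range \<tau> = range \<sigma> - D"
      unfolding \<tau>_def by (rule range_from_nat_into[OF False]) blast
    have "\<tau> n \<in> range \<sigma> - D" for n using \<tau> by blast
    then have rs: "range (s \<circ> \<tau>) \<subseteq> topspace X" using s by auto
    let ?K = "X closure_of range (s \<circ> \<tau>)"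
    have "compactin X ?K" using assms rs unfolding omega_bounded_space_def by blast
    then have "compactin Y (T ` ?K)" by (rule image_compactin[OF _ cont])
    moreover have "range \<sigma> - D \<subseteq> T ` ?K"
    proof
      fix y assume y: "y \<in> range \<sigma> - D"
      then obtain n where "y = \<tau> n" using \<tau> by blast
      then have "s y \<in> range (s \<circ> \<tau>)" by auto
      then have "s y \<in> ?K" using closure_of_subset[OF rs] by blast
      then show "y \<in> T ` ?K" using s[OF y] by blast
    qed
    ultimately show ?thesis by blast
  qed
  then obtain C' where C': "compactin Y C'" "range \<sigma> - D \<subseteq> C'" by blast
  show "compactin Y (Y closure_of range \<sigma>)"
    by (rule compactin_closure_of_subset[OF Hausdorff compactin_Un[OF C(1) C'(1)]])
      (use C C' in blast)
qed

lemma totally_countably_compact: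
  assumes "totally_countably_compact_space X"
  shows "totally_countably_compact_space Y"
  unfolding totally_countably_compact_space_def
proof (intro allI impI)
  fix \<sigma> :: "nat \<Rightarrow> 'a" assume "range \<sigma> \<subseteq> topspace Y"
  then show "\<exists>r :: nat \<Rightarrow> nat. strict_mono r \<and> compactin Y (Y closure_of range (\<sigma> \<circ> r))"
  proof (cases rule: split_sequence)
    case (1 r)
    obtain C where "compactin Y C" "range (\<sigma> \<circ> r) \<subseteq> C"
      using countable_compact_hull[of "range (\<sigma> \<circ> r)"] 1(2) by blast
    then have "compactin Y (Y closure_of range (\<sigma> \<circ> r))"
      by (rule compactin_closure_of_subset[OF Hausdorff])
    with 1 show ?thesis by blast
  next
    case (2 r \<xi>)
    obtain r' :: "nat \<Rightarrow> nat" where r': "strict_mono r'"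
        "compactin X (X closure_of range (\<xi> \<circ> r'))"
      using assms 2(2) unfolding totally_countably_compact_space_def by blast
    have image: "compactin Y (T ` (X closure_of range (\<xi> \<circ> r')))"
      by (rule image_compactin[OF r'(2) cont])
    have "range (\<xi> \<circ> r') \<subseteq> X closure_of range (\<xi> \<circ> r')"
      by (rule closure_of_subset) (use 2(2) in auto)
    then have "T ` range (\<xi> \<circ> r') \<subseteq> T ` (X closure_of range (\<xi> \<circ> r'))"
      by (rule image_mono)
    moreover have "\<sigma> \<circ> (r \<circ> r') = T \<circ> (\<xi> \<circ> r')"
      using 2(3) by (simp add: comp_assoc[symmetric])
    ultimately have "range (\<sigma> \<circ> (r \<circ> r')) \<subseteq> T ` (X closure_of range (\<xi> \<circ> r'))"
      by (simp only: image_comp)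
    with image have "compactin Y (Y closure_of range (\<sigma> \<circ> (r \<circ> r')))"
      by (rule compactin_closure_of_subset[OF Hausdorff])
    then show ?thesis using strict_mono_o[OF 2(1) r'(1)] by blast
  qed
qed

lemma countably_compact:
  assumes "countably_compact_space X"
  shows "countably_compact_space Y"
  unfolding countably_compact_space_def
proof (intro allI impI)
  fix \<sigma> :: "nat \<Rightarrow> 'a" assume \<sigma>: "range \<sigma> \<subseteq> topspace Y"
  obtain r y where r: "strict_mono (r :: nat \<Rightarrow> nat)" and y: "y \<in> topspace Y"
    and inf: "\<And>U. openin Y U \<Longrightarrow> y \<in> U \<Longrightarrow> infinite {n. (\<sigma> \<circ> r) n \<in> U}"
  proof (rule split_sequence[OF \<sigma>])
    fix r :: "nat \<Rightarrow> nat" assume 1: "strict_mono r" "range (\<sigma> \<circ> r) \<subseteq> D"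
    obtain l s where l: "l \<in> D" "strict_mono (s :: nat \<Rightarrow> nat)" "limitin Y (\<sigma> \<circ> r \<circ> s) l sequentially"
      using convergent_subsequence[OF 1(2)] by blast
    show thesis
    proof (rule that[of "r \<circ> s" l])
      show "strict_mono (r \<circ> s)" by (rule strict_mono_o[OF 1(1) l(2)])
      show "l \<in> topspace Y" using l core_subset by blast
      fix U assume "openin Y U" "l \<in> U"
      then have "\<forall>\<^sub>F n in sequentially. (\<sigma> \<circ> r \<circ> s) n \<in> U"
        using l(3) by (simp add: limitin_def)
      then obtain N where "{N..} \<subseteq> {n. (\<sigma> \<circ> (r \<circ> s)) n \<in> U}"
        by (auto simp: eventually_sequentially)
      then show "infinite {n. (\<sigma> \<circ> (r \<circ> s)) n \<in> U}"
        by (rule infinite_super[OF _ infinite_Ici])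
    qed
  next
    fix r :: "nat \<Rightarrow> nat" and \<xi> assume 2: "strict_mono r" "range \<xi> \<subseteq> topspace X" "\<sigma> \<circ> r = T \<circ> \<xi>"
    have "\<exists>x\<in>topspace X. \<forall>U. openin X U \<and> x \<in> U \<longrightarrow> infinite {n. \<xi> n \<in> U}"
      using assms 2(2) unfolding countably_compact_space_def by blast
    then obtain x where x: "x \<in> topspace X" "\<And>U. openin X U \<Longrightarrow> x \<in> U \<Longrightarrow> infinite {n. \<xi> n \<in> U}"
      by auto
    show thesis
    proof (rule that[of r "T x"])
      show "strict_mono r" by fact
      show "T x \<in> topspace Y" using cover x by blast
      fix U assume U: "openin Y U" "T x \<in> U"
      have "openin X {z \<in> topspace X. T z \<in> U}"
        by (rule openin_continuous_map_preimage[OF cont U(1)])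
      from x(2)[OF this] have "infinite {n. \<xi> n \<in> topspace X \<and> T (\<xi> n) \<in> U}" using x U by simp
      moreover have "{n. \<xi> n \<in> topspace X \<and> T (\<xi> n) \<in> U} \<subseteq> {n. (\<sigma> \<circ> r) n \<in> U}"
        using 2(3) by (auto simp: fun_eq_iff)
      ultimately show "infinite {n. (\<sigma> \<circ> r) n \<in> U}" by (rule infinite_super[rotated])
    qed
  qed
  show "\<exists>x\<in>topspace Y. \<forall>U. openin Y U \<and> x \<in> U \<longrightarrow> infinite {n. \<sigma> n \<in> U}"
  proof (intro bexI[OF _ y] allI impI)
    fix U assume "openin Y U \<and> y \<in> U"
    then have "infinite {n. (\<sigma> \<circ> r) n \<in> U}" using inf by blast
    \<comment> \<open>Injectivity of \<open>r\<close> carries infinitely many indices of the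
      subsequence to infinitely many indices of \<open>\<sigma>\<close>, so \<open>y\<close> is also
      a cluster point of \<open>\<sigma>\<close>.\<close>
    moreover have "inj_on r {n. (\<sigma> \<circ> r) n \<in> U}"
      by (rule inj_on_subset[OF strict_mono_imp_inj_on[OF r] subset_UNIV])
    ultimately have "infinite (r ` {n. (\<sigma> \<circ> r) n \<in> U})"
      by (simp add: finite_image_iff)
    moreover have "r ` {n. (\<sigma> \<circ> r) n \<in> U} \<subseteq> {n. \<sigma> n \<in> U}" by auto
    ultimately show "infinite {n. \<sigma> n \<in> U}" by (rule infinite_super[rotated])
  qed
qed

end

end

section \<open>\<open>\<Sigma>\<close>-products in cubes\<close>

definition unit_cube :: "'i set \<Rightarrow> ('i \<Rightarrow> real) topology" where
  "unit_cube I = product_topology (\<lambda>i. top_of_set {0..1}) I"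

definition coord_support :: "'i set \<Rightarrow> ('i \<Rightarrow> real) \<Rightarrow> 'i set" where
  "coord_support I p = {i \<in> I. p i \<noteq> 0}"

definition sigma_product :: "'i set \<Rightarrow> ('i \<Rightarrow> real) set" where
  "sigma_product I = {p \<in> topspace (unit_cube I). countable (coord_support I p)}"

text \<open>Cuts supply the limit points of the later arguments: a cut to a countable
  \<open>S\<close> lies in the \<Sigma>-product, while a cut to an uncountable \<open>S\<close> may
  leave it.\<close>

definition cut :: "'i set \<Rightarrow> 'i set \<Rightarrow> ('i \<Rightarrow> real) \<Rightarrow> 'i \<Rightarrow> real" where
  "cut I S q = (\<lambda>i\<in>I. if i \<in> S then q i else 0)"

lemma topspace_unit_cube: "topspace (unit_cube I) = (\<Pi>\<^sub>E i\<in>I. {0..1})"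
  by (simp add: unit_cube_def)

lemma compact_space_unit_cube: "compact_space (unit_cube I)"
  unfolding unit_cube_def compact_space_product_topology
  by (simp add: compact_space_subtopology)

lemma Hausdorff_space_unit_cube: "Hausdorff_space (unit_cube I)"
  unfolding unit_cube_def Hausdorff_space_product_topology
  by (simp add: Hausdorff_space_subtopology)

lemma normal_space_unit_cube: "normal_space (unit_cube I)"
  by (simp add: compact_Hausdorff_or_regular_imp_normal_space compact_space_unit_cube
      Hausdorff_space_unit_cube)

lemma completely_regular_space_unit_cube: "completely_regular_space (unit_cube I)"
  unfolding unit_cube_def completely_regular_space_product_topology
  by (simp add: completely_regular_space_subtopology metrizable_imp_completely_regular_space metrizable_space_euclidean)

lemma continuous_map_coordinate:
  assumes "i \<in> I"
  shows "continuous_map (unit_cube I) euclideanreal (\<lambda>p. p i)"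
  using continuous_map_product_projection[OF assms, of "\<lambda>i. top_of_set {0..1::real}"]
  unfolding unit_cube_def by (simp add: continuous_map_in_subtopology)

lemma continuous_map_into_unit_cube:
  assumes "\<And>i. i \<in> I \<Longrightarrow> continuous_map X (top_of_set {0..1}) (\<lambda>x. f x i)"
    and "\<And>x. x \<in> topspace X \<Longrightarrow> f x \<in> extensional I"
  shows "continuous_map X (unit_cube I) f"
  using assms unfolding unit_cube_def continuous_map_componentwise by auto

lemma openin_unit_cube_box:
  assumes "finite F" "F \<subseteq> I"
  shows "openin (unit_cube I) {p \<in> topspace (unit_cube I). \<forall>i\<in>F. \<bar>p i - q i\<bar> < \<epsilon>}"
proof -
  have "openin (unit_cube I) {p \<in> topspace (unit_cube I). p i \<in> ball (q i) \<epsilon>}" if "i \<in> F" for i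
    by (rule openin_continuous_map_preimage[OF continuous_map_coordinate]) (use assms that in auto)
  then have "openin (unit_cube I)
      (topspace (unit_cube I) \<inter> \<Inter> ((\<lambda>i. {p \<in> topspace (unit_cube I). p i \<in> ball (q i) \<epsilon>}) ` F))"
    using assms(1) by (intro openin_Int_Inter) auto
  moreover have "topspace (unit_cube I) \<inter> \<Inter> ((\<lambda>i. {p \<in> topspace (unit_cube I). p i \<in> ball (q i) \<epsilon>}) ` F)
     = {p \<in> topspace (unit_cube I). \<forall>i\<in>F. \<bar>p i - q i\<bar> < \<epsilon>}"
    by (auto simp: dist_real_def abs_minus_commute)
  ultimately show ?thesis by simp
qed

lemma unit_cube_box_neighbourhood:
  assumes "openin (unit_cube I) W" "q \<in> W"
  obtains F \<epsilon> where "finite F" "F \<subseteq> I" "\<epsilon> > 0"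
    "\<And>p. p \<in> topspace (unit_cube I) \<Longrightarrow> (\<And>i. i \<in> F \<Longrightarrow> \<bar>p i - q i\<bar> < \<epsilon>) \<Longrightarrow> p \<in> W"
proof -
  obtain U where U: "finite {i \<in> I. U i \<noteq> {0..1}}" "\<And>i. i \<in> I \<Longrightarrow> openin (top_of_set {0..1}) (U i)"
      "q \<in> Pi\<^sub>E I U" "Pi\<^sub>E I U \<subseteq> W"
    using assms unfolding unit_cube_def openin_product_topology_alt by auto
  define F where "F = {i \<in> I. U i \<noteq> {0..1}}"
  have "\<exists>e>0. \<forall>x\<in>{0..1}. \<bar>x - q i\<bar> < e \<longrightarrow> x \<in> U i" if "i \<in> F" for i
  proof -
    have "openin (top_of_set {0..1}) (U i)" "q i \<in> U i"
      using that U by (auto simp: F_def)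
    then show ?thesis by (auto simp: openin_euclidean_subtopology_iff dist_real_def)
  qed
  then obtain e where e: "\<And>i. i \<in> F \<Longrightarrow> e i > 0 \<and> (\<forall>x\<in>{0..1}. \<bar>x - q i\<bar> < e i \<longrightarrow> x \<in> U i)"
    by metis
  \<comment> \<open>The inserted \<open>1\<close> covers the case of no restricted
    coordinate.\<close>
  define \<epsilon> where "\<epsilon> = Min (insert 1 (e ` F))"
  have F: "finite F" "F \<subseteq> I" using U(1) by (auto simp: F_def)
  show thesis
  proof (rule that[OF F])
    show "\<epsilon> > 0" using e F(1) by (auto simp: \<epsilon>_def)
    fix p assume p: "p \<in> topspace (unit_cube I)" and near: "\<And>i. i \<in> F \<Longrightarrow> \<bar>p i - q i\<bar> < \<epsilon>"
    have "p i \<in> U i" if "i \<in> I" for i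
    proof (cases "i \<in> F")
      case True
      have "\<epsilon> \<le> e i" unfolding \<epsilon>_def using F(1) True by (intro Min_le) auto
      then have "\<bar>p i - q i\<bar> < e i" using near[OF True] by linarith
      moreover have "p i \<in> {0..1}" using p that by (auto simp: topspace_unit_cube)
      ultimately show ?thesis using e[OF True] by blast
    next
      case False
      then show ?thesis using p that by (auto simp: F_def topspace_unit_cube)
    qed
    then have "p \<in> Pi\<^sub>E I U" using p by (auto simp: topspace_unit_cube PiE_iff)
    then show "p \<in> W" using U(4) by blast
  qed
qed

lemma limitin_unit_cube:
  assumes "\<And>n. \<sigma> n \<in> topspace (unit_cube I)" "l \<in> topspace (unit_cube I)"
    and "\<And>i. i \<in> I \<Longrightarrow> (\<lambda>n. \<sigma> n i) \<longlonglongrightarrow> l i"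
  shows "limitin (unit_cube I) \<sigma> l sequentially"
  unfolding unit_cube_def limitin_componentwise
proof (intro conjI ballI)
  show "l \<in> extensional I" using assms(2) by (simp add: topspace_unit_cube PiE_iff)
  show "\<forall>\<^sub>F n in sequentially. \<sigma> n \<in> topspace (product_topology (\<lambda>i. top_of_set {0..1}) I)"
    using assms(1) by (simp add: unit_cube_def)
  fix i assume i: "i \<in> I"
  have "\<sigma> n i \<in> {0..1}" "l i \<in> {0..1}" for n
    using assms(1)[of n] assms(2) i by (auto simp: topspace_unit_cube PiE_iff)
  then show "limitin (top_of_set {0..1}) (\<lambda>n. \<sigma> n i) (l i) sequentially"
    using assms(3)[OF i] by (simp add: limitin_subtopology limitin_canonical_iff)
qed

section \<open>Faces of the cube and sequences in the \<Sigma>-product\<close>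

lemma cut_in_unit_cube:
  "q \<in> topspace (unit_cube I) \<Longrightarrow> cut I S q \<in> topspace (unit_cube I)"
  by (auto simp: topspace_unit_cube cut_def PiE_iff)

lemma cut_in_sigma_product:
  assumes "q \<in> topspace (unit_cube I)" "countable S"
  shows "cut I S q \<in> sigma_product I"
proof -
  have "coord_support I (cut I S q) \<subseteq> S" by (auto simp: coord_support_def cut_def)
  then show ?thesis
    using assms by (simp add: sigma_product_def cut_in_unit_cube countable_subset)
qed

lemma sigma_product_subset: "sigma_product I \<subseteq> topspace (unit_cube I)"
  by (auto simp: sigma_product_def)

lemma countable_support_UN:
  "(\<And>n::nat. p n \<in> sigma_product I) \<Longrightarrow> countable (\<Union>n. coord_support I (p n))"
  by (auto simp: sigma_product_def)

text \<open>Countably many countable supports have a countable union \<open>S\<close>. The face over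
  \<open>S\<close> will serve as the hull: it is compact as a product of compact factors, metrizable
  since all factors outside \<open>S\<close> are singletons, and contained in the
  \<Sigma>-product.\<close>

lemma sigma_product_compact_hull:
  assumes "countable A" "A \<subseteq> sigma_product I"
  obtains S where "countable S" "S \<subseteq> I" "A \<subseteq> (\<Pi>\<^sub>E i\<in>I. if i \<in> S then {0..1} else {0})"
proof -
  define S where "S = (\<Union>p\<in>A. coord_support I p)"
  have "countable S" using assms by (auto simp: S_def sigma_product_def)
  moreover have "S \<subseteq> I" by (auto simp: S_def coord_support_def)
  moreover have "A \<subseteq> (\<Pi>\<^sub>E i\<in>I. if i \<in> S then {0..1} else {0})"
    using assms(2) sigma_product_subset[of I]
    by (force simp: S_def coord_support_def topspace_unit_cube PiE_iff)
  ultimately show thesis by (rule that)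
qed

lemma subtopology_unit_cube_face:
  "subtopology (unit_cube I) (\<Pi>\<^sub>E i\<in>I. if i \<in> S then {0..1} else {0})
     = product_topology (\<lambda>i. top_of_set (if i \<in> S then {0..1} else {0})) I"
proof -
  have "subtopology (top_of_set {0..1}) (if i \<in> S then {0..1} else {0}) =
      top_of_set (if i \<in> S then {0..1::real} else {0})" for i
    by (simp add: subtopology_subtopology)
  then show ?thesis by (simp only: unit_cube_def subtopology_product_topology)
qed

lemma face_subset_sigma_product:
  assumes "countable S"
  shows "(\<Pi>\<^sub>E i\<in>I. if i \<in> S then {0..1} else {0}) \<subseteq> sigma_product I"
proof
  fix p :: "'a \<Rightarrow> real" assume p: "p \<in> (\<Pi>\<^sub>E i\<in>I. if i \<in> S then {0..1} else {0})"
  then have "coord_support I p \<subseteq> S" by (fastforce simp: coord_support_def PiE_iff split: if_splits)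
  moreover have "p \<in> topspace (unit_cube I)"
    using p by (force simp: topspace_unit_cube PiE_iff split: if_splits)
  ultimately show "p \<in> sigma_product I"
    using assms by (simp add: sigma_product_def countable_subset)
qed

lemma compact_space_face:
  "compact_space (product_topology (\<lambda>i. top_of_set (if i \<in> S then {0..1::real} else {0})) I)"
  unfolding compact_space_product_topology by (simp add: compact_space_subtopology)

lemma metrizable_space_face:
  assumes "countable S"
  shows "metrizable_space (product_topology (\<lambda>i. top_of_set (if i \<in> S then {0..1::real} else {0})) I)"
  unfolding metrizable_space_product_topology
proof (rule disjI2, intro conjI ballI)
  have "{i \<in> I. \<not> (\<exists>a. topspace (top_of_set (if i \<in> S then {0..1::real} else {0})) \<subseteq> {a})} \<subseteq> S"
    by auto
  then show "countable {i \<in> I. \<not> (\<exists>a. topspace (top_of_set (if i \<in> S then {0..1::real} else {0})) \<subseteq> {a})}"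
    using assms countable_subset by blast
qed (simp add: metrizable_space_subtopology metrizable_space_euclidean)

text \<open>A sequence in the \<Sigma>-product lies in one face over a countable set, and a compact
  metrizable face is sequentially compact.\<close>

lemma sigma_product_convergent_subsequence:
  assumes "range \<sigma> \<subseteq> sigma_product I"
  shows "\<exists>l \<in> sigma_product I. \<exists>r :: nat \<Rightarrow> nat. strict_mono r \<and>
           limitin (unit_cube I) (\<sigma> \<circ> r) l sequentially"
proof -
  obtain S where S: "countable S" "S \<subseteq> I" "range \<sigma> \<subseteq> (\<Pi>\<^sub>E i\<in>I. if i \<in> S then {0..1} else {0})"
    using sigma_product_compact_hull[of "range \<sigma>" I] assms by auto
  let ?C = "\<Pi>\<^sub>E i\<in>I. if i \<in> S then {0..1::real} else {0}"
  let ?P = "product_topology (\<lambda>i. top_of_set (if i \<in> S then {0..1::real} else {0})) I"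
  obtain M d where M: "Metric_space M d" "?P = Metric_space.mtopology M d"
    using metrizable_space_face[OF S(1)] unfolding metrizable_space_def by blast
  interpret Metric_space M d by (rule M(1))
  have top: "topspace ?P = ?C" by (auto simp: PiE_iff extensional_def)
  then have "M = ?C" using M(2) topspace_mtopology by metis
  moreover have "compact_space mtopology" using compact_space_face[of S I] M(2) by simp
  ultimately obtain l r where "l \<in> ?C" "strict_mono (r :: nat \<Rightarrow> nat)" "limitin ?P (\<sigma> \<circ> r) l sequentially"
    using S(3) M(2) unfolding compact_space_sequentially by metis
  moreover from this have "limitin (unit_cube I) (\<sigma> \<circ> r) l sequentially"
    by (simp add: subtopology_unit_cube_face[symmetric] limitin_subtopology)
  ultimately show ?thesis using face_subset_sigma_product[OF S(1)] by blast
qed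

text \<open>The sequences are chosen so that they approach \<open>q\<close> on every coordinate in the support of any
  of their terms; on all other coordinates they vanish, so they converge to the restriction of
  \<open>q\<close> to a countable set of coordinates.\<close>

lemma sigma_product_paired_sequences:
  assumes q: "q \<in> topspace (unit_cube I)" and R: "R \<subseteq> sigma_product I \<times> sigma_product I"
    and meets: "\<And>W. openin (unit_cube I) W \<Longrightarrow> q \<in> W \<Longrightarrow> R \<inter> W \<times> W \<noteq> {}"
  shows "\<exists>u v. \<exists>l\<in>sigma_product I. (\<forall>n :: nat. (u n, v n) \<in> R) \<and>
           limitin (unit_cube I) u l sequentially \<and> limitin (unit_cube I) v l sequentially"
proof -
  define A where "A z = coord_support I (fst z) \<union> coord_support I (snd z)" for z :: "('a \<Rightarrow> real) \<times> ('a \<Rightarrow> real)"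
  \<comment> \<open>Bookkeeping: stage \<open>n\<close> handles the first \<open>n\<close> listed
    elements of the supports of the first \<open>n\<close> pairs. Intersecting with \<open>I\<close>
    removes the arbitrary value that \<open>from_nat_into\<close> takes on an empty support.\<close>
  define F where "F f n = (\<Union>k<n. from_nat_into (A (f k)) ` {..<n}) \<inter> I"
    for f :: "nat \<Rightarrow> ('a \<Rightarrow> real) \<times> ('a \<Rightarrow> real)" and n :: nat
  define P where "P f n z \<longleftrightarrow> z \<in> R \<and> (\<forall>i\<in>F f n. \<bar>fst z i - q i\<bar> < 1 / Suc n \<and> \<bar>snd z i - q i\<bar> < 1 / Suc n)"
    for f n z
  \<comment> \<open>Dependent choice: the condition on the \<open>n\<close>th pair refers only to
    the earlier pairs, through \<open>F f n\<close>.\<close>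
  have "\<exists>f. \<forall>n. P f n (f n)"
  proof (rule dependent_wf_choice[OF wf_less_than])
    fix f g :: "nat \<Rightarrow> ('a \<Rightarrow> real) \<times> ('a \<Rightarrow> real)" and n r assume "\<And>k. (k, n) \<in> less_than \<Longrightarrow> f k = g k"
    then have "F f n = F g n" by (simp add: F_def)
    then show "P f n r = P g n r" by (simp add: P_def)
  next
    fix n and f :: "nat \<Rightarrow> ('a \<Rightarrow> real) \<times> ('a \<Rightarrow> real)"
    let ?W = "{p \<in> topspace (unit_cube I). \<forall>i\<in>F f n. \<bar>p i - q i\<bar> < 1 / Suc n}"
    have "finite (F f n)" by (simp add: F_def)
    then have "openin (unit_cube I) ?W" by (rule openin_unit_cube_box) (auto simp: F_def)
    moreover have "q \<in> ?W" using q by simp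
    ultimately show "\<exists>z. P f n z" using meets[of ?W] by (auto simp: P_def)
  qed
  then obtain f where f: "\<And>n. P f n (f n)" by blast
  define S where "S = (\<Union>k. A (f k))"
  have fR: "f n \<in> R" for n using f[of n] by (simp add: P_def)
  then have mem: "fst (f n) \<in> sigma_product I" "snd (f n) \<in> sigma_product I" for n
    using subsetD[OF R fR] by (auto simp: mem_Times_iff)
  have cA: "countable (A (f k))" for k using mem[of k] by (simp add: A_def sigma_product_def)
  then have "countable S" by (simp add: S_def)
  have near: "\<forall>\<^sub>F n in sequentially. \<bar>fst (f n) i - q i\<bar> < 1 / Suc n \<and> \<bar>snd (f n) i - q i\<bar> < 1 / Suc n"
    if i: "i \<in> I" "i \<in> S" for i
  proof -
    \<comment> \<open>The coordinate \<open>i\<close> is entry \<open>m\<close> in the list of the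
      \<open>k\<close>th support, hence it is handled at every stage beyond both \<open>k\<close>
      and \<open>m\<close>.\<close>
    obtain k m where "i = from_nat_into (A (f k)) m"
      using i(2) from_nat_into_surj[OF cA] unfolding S_def by blast
    then have "i \<in> F f n" if "n \<ge> Suc (max k m)" for n
      unfolding F_def using that i(1) \<open>i = _\<close>
      by (intro IntI UN_I[of k] image_eqI[of _ _ m]) auto
    then show ?thesis
      using f unfolding P_def eventually_sequentially by blast
  qed
  have lim: "(\<lambda>n. u n i) \<longlonglongrightarrow> cut I S q i"
    if i: "i \<in> I" and u: "\<And>n. coord_support I (u n) \<subseteq> A (f n)"
      and close: "i \<in> S \<Longrightarrow> \<forall>\<^sub>F n in sequentially. \<bar>u n i - q i\<bar> < 1 / Suc n" for u i
  proof (cases "i \<in> S")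
    case True
    have "(\<lambda>n. u n i - q i) \<longlonglongrightarrow> 0"
    proof (rule Lim_null_comparison)
      show "\<forall>\<^sub>F n in sequentially. norm (u n i - q i) \<le> 1 / Suc n"
        using close[OF True] by eventually_elim simp
      show "(\<lambda>n. 1 / real (Suc n)) \<longlonglongrightarrow> 0" by (rule LIMSEQ_Suc[OF lim_1_over_n])
    qed
    then show ?thesis using True i by (simp add: cut_def LIM_zero_iff)
  next
    case False
    then have "u n i = 0" for n using u[of n] i by (auto simp: S_def coord_support_def)
    then show ?thesis using False i by (simp add: cut_def)
  qed
  have "limitin (unit_cube I) (\<lambda>n. fst (f n)) (cut I S q) sequentially"
  proof (rule limitin_unit_cube)
    fix i assume "i \<in> I"
    then show "(\<lambda>n. fst (f n) i) \<longlonglongrightarrow> cut I S q i"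
      by (rule lim) (use near[OF \<open>i \<in> I\<close>] in \<open>auto simp: A_def elim: eventually_mono\<close>)
  qed (use mem sigma_product_subset cut_in_unit_cube[OF q] in blast)+
  moreover have "limitin (unit_cube I) (\<lambda>n. snd (f n)) (cut I S q) sequentially"
  proof (rule limitin_unit_cube)
    fix i assume "i \<in> I"
    then show "(\<lambda>n. snd (f n) i) \<longlonglongrightarrow> cut I S q i"
      by (rule lim) (use near[OF \<open>i \<in> I\<close>] in \<open>auto simp: A_def elim: eventually_mono\<close>)
  qed (use mem sigma_product_subset cut_in_unit_cube[OF q] in blast)+
  moreover have "cut I S q \<in> sigma_product I"
    by (rule cut_in_sigma_product[OF q \<open>countable S\<close>])
  ultimately show ?thesis
    using fR by (intro exI[of _ "\<lambda>n. fst (f n)"] exI[of _ "\<lambda>n. snd (f n)"]) auto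
qed

section \<open>Extensions of the \<open>\<Sigma>\<close>-product\<close>

lemma card_UN_Fpow_le:
  assumes A: "infinite A" and B: "infinite B" "|B| \<le>o |A|" and G: "\<And>F. F \<in> Fpow B \<Longrightarrow> countable (G F)"
  shows "|\<Union>F\<in>Fpow B. G F| \<le>o |A|"
proof (rule card_of_UNION_ordLeq_infinite[OF A])
  show "|Fpow B| \<le>o |A|"
    by (rule ordIso_ordLeq_trans[OF card_of_Fpow_infinite[OF B(1)] B(2)])
  have "|UNIV :: nat set| \<le>o |A|" using A by (simp add: infinite_iff_card_of_nat)
  then show "\<forall>F\<in>Fpow B. |G F| \<le>o |A|"
    using G ordLeq_transitive unfolding countable_card_of_nat by blast
qed

text \<open>A Loewenheim-Skolem closure: adjoin the values of \<open>G\<close> on all finite subsets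
  and repeat this countably often. An infinite set has only as many finite subsets as elements, so
  the size stays that of \<open>A\<close>, and a finite subset of the union already lies in one
  stage.\<close>

lemma set_closed_under_finitary_operation:
  assumes A: "infinite A" "A \<subseteq> I"
    and G: "\<And>F. finite F \<Longrightarrow> F \<subseteq> I \<Longrightarrow> countable (G F) \<and> G F \<subseteq> I"
  obtains S where "A \<subseteq> S" "S \<subseteq> I" "|S| \<le>o |A|" "\<And>F. finite F \<Longrightarrow> F \<subseteq> S \<Longrightarrow> G F \<subseteq> S"
proof -
  define T where "T = rec_nat A (\<lambda>_ B. B \<union> (\<Union>F\<in>Fpow B. G F))"
  have T0: "T 0 = A" and TS: "T (Suc n) = T n \<union> (\<Union>F\<in>Fpow (T n). G F)" for n
    by (simp_all add: T_def)
  have mono: "T m \<subseteq> T n" if "m \<le> n" for m n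
    by (rule lift_Suc_mono_le[OF _ that]) (auto simp: TS)
  then have AT: "A \<subseteq> T n" for n using T0 by (metis le0)
  have TI: "T n \<subseteq> I" for n
  proof (induction n)
    case (Suc n)
    then have "G F \<subseteq> I" if "F \<in> Fpow (T n)" for F using that G[of F] by (auto simp: Fpow_def)
    then show ?case using Suc by (auto simp: TS)
  qed (use T0 A in simp)
  have Tc: "|T n| \<le>o |A|" for n
  proof (induction n)
    case 0
    show ?case by (simp add: T0)
  next
    case (Suc n)
    have "infinite (T n)" using A(1) AT infinite_super by blast
    then have "|\<Union>F\<in>Fpow (T n). G F| \<le>o |A|"
      using Suc TI[of n] G by (intro card_UN_Fpow_le[OF A(1)]) (auto simp: Fpow_def)
    then have "|T n \<union> (\<Union>F\<in>Fpow (T n). G F)| \<le>o |A|"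
      using card_of_Un_ordLeq_infinite_Field[of "|A|"] Suc A(1) by simp
    then show ?case by (simp only: TS)
  qed
  show thesis
  proof (rule that[of "\<Union>n. T n"])
    show "A \<subseteq> (\<Union>n. T n)" using T0 by blast
    show "(\<Union>n. T n) \<subseteq> I" using TI by blast
    show "|\<Union>n. T n| \<le>o |A|"
      by (rule card_of_UNION_ordLeq_infinite[OF A(1)])
        (use Tc A(1) in \<open>auto simp: infinite_iff_card_of_nat\<close>)
    fix F assume F: "finite F" "F \<subseteq> (\<Union>n. T n)"
    have "\<exists>n. F \<subseteq> T n"
      using F
    proof (induction F)
      case (insert x F)
      then obtain m n where "F \<subseteq> T m" "x \<in> T n" by blast
      then have "insert x F \<subseteq> T (max m n)" using mono[of m "max m n"] mono[of n "max m n"] by auto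
      then show ?case by blast
    qed simp
    then obtain n where "F \<in> Fpow (T n)" using F(1) by (auto simp: Fpow_def)
    then have "G F \<subseteq> T (Suc n)" by (auto simp: TS)
    then show "G F \<subseteq> (\<Union>n. T n)" by blast
  qed
qed

lemma base_of_iff:
  "base_of X \<B> \<longleftrightarrow> (\<forall>B\<in>\<B>. openin X B) \<and> (\<forall>U x. openin X U \<and> x \<in> U \<longrightarrow> (\<exists>B\<in>\<B>. x \<in> B \<and> B \<subseteq> U))"
  unfolding base_of_def openin_topology_base_unique by blast

lemma rational_between_in_nbhd:
  fixes x :: real
  assumes "\<epsilon> > 0"
  shows "\<exists>a b :: rat. of_rat a < x \<and> x < of_rat b \<and> x - \<epsilon> < of_rat a \<and> of_rat b < x + \<epsilon>"
proof -
  obtain a where "x - \<epsilon> < of_rat a" "of_rat a < x"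
    using of_rat_dense[of "x - \<epsilon>" x] assms by auto
  moreover obtain b where "x < of_rat b" "of_rat b < x + \<epsilon>"
    using of_rat_dense[of x "x + \<epsilon>"] assms by auto
  ultimately show ?thesis by blast
qed

text \<open>Two gaps between cardinals drive the argument: \<open>L1\<close> is uncountable, so a
  point that is nonzero on \<open>L1\<close> leaves the \<Sigma>-product; \<open>L\<close> is larger
  than \<open>L1\<close>, so a set of the size of \<open>L1\<close> cannot cover \<open>L\<close>.
  The value \<open>1\<close> on \<open>L\<close> is the mark by which points of \<open>E\<close> are
  recognised.\<close>

locale sigma_extension =
  fixes I L L1 :: "'i set" and E :: "('i \<Rightarrow> real) set"
  assumes L: "L \<subseteq> I" and L1: "L1 \<subseteq> L" "uncountable L1" "|L1| <o |L|"
    and E: "E \<subseteq> topspace (unit_cube I)" "E \<noteq> {}" "\<And>q l. q \<in> E \<Longrightarrow> l \<in> L \<Longrightarrow> q l = 1"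
begin

definition Z :: "('i \<Rightarrow> real) topology" where
  "Z = subtopology (unit_cube I) (sigma_product I \<union> E)"

lemma topspace_Z: "topspace Z = sigma_product I \<union> E"
  using sigma_product_subset[of I] E(1) by (auto simp: Z_def)

lemma topspace_Z_subset: "topspace Z \<subseteq> topspace (unit_cube I)"
  by (simp add: Z_def)

lemma continuous_map_Z_coordinate: "i \<in> I \<Longrightarrow> continuous_map Z euclideanreal (\<lambda>p. p i)"
  unfolding Z_def by (rule continuous_map_from_subtopology[OF continuous_map_coordinate])

lemma Hausdorff_Z: "Hausdorff_space Z"
  by (simp add: Z_def Hausdorff_space_subtopology Hausdorff_space_unit_cube)

lemma tychonoff_Z: "tychonoff_space Z"
  by (simp add: tychonoff_space_def Hausdorff_Z)
    (simp add: Z_def completely_regular_space_subtopology completely_regular_space_unit_cube)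

lemma sigma_product_vanishes_in_L:
  assumes "p \<in> sigma_product I" shows "\<exists>l\<in>L. p l = 0"
proof (rule ccontr)
  assume "\<not> ?thesis"
  then have "L1 \<subseteq> coord_support I p" using L L1(1) by (auto simp: coord_support_def)
  then show False using assms L1(2) countable_subset by (auto simp: sigma_product_def)
qed

lemma sigma_product_Int_E: "sigma_product I \<inter> E = {}"
proof -
  have False if "p \<in> sigma_product I" "p \<in> E" for p
    using sigma_product_vanishes_in_L[OF that(1)] E(3)[OF that(2)] by auto
  then show ?thesis by blast
qed

text \<open>Every point of the \<Sigma>-product vanishes somewhere on \<open>L\<close>, so within
  \<open>Z\<close> the set \<open>E\<close> is cut out by the closed conditions
  \<open>p l = 1\<close> for \<open>l \<in> L\<close>.\<close>

lemma closedin_E: "closedin Z E"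
proof -
  have "closedin Z {p \<in> topspace Z. p l \<in> {1}}" if "l \<in> L" for l
    by (rule closedin_continuous_map_preimage[OF continuous_map_Z_coordinate]) (use that L in auto)
  moreover have "L \<noteq> {}" using L1 by auto
  ultimately have "closedin Z (\<Inter>l\<in>L. {p \<in> topspace Z. p l \<in> {1}})"
    by (intro closedin_INT) auto
  moreover have "(\<Inter>l\<in>L. {p \<in> topspace Z. p l \<in> {1}}) = E"
  proof
    show "(\<Inter>l\<in>L. {p \<in> topspace Z. p l \<in> {1}}) \<subseteq> E"
    proof
      fix p assume p: "p \<in> (\<Inter>l\<in>L. {p \<in> topspace Z. p l \<in> {1}})"
      then have "p \<in> topspace Z" using \<open>L \<noteq> {}\<close> by blast
      moreover have "p \<notin> sigma_product I" using sigma_product_vanishes_in_L[of p] p by fastforce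
      ultimately show "p \<in> E" by (simp add: topspace_Z)
    qed
    show "E \<subseteq> (\<Inter>l\<in>L. {p \<in> topspace Z. p l \<in> {1}})" using E by (auto simp: topspace_Z)
  qed
  ultimately show ?thesis by simp
qed

text \<open>A basic neighbourhood of \<open>q\<close> restricts finitely many coordinates; cutting
  \<open>q\<close> to these gives a point of finite support inside it.\<close>

lemma sigma_product_meets_open:
  assumes "openin (unit_cube I) W" "q \<in> W"
  shows "\<exists>p\<in>sigma_product I. p \<in> W"
proof -
  have q: "q \<in> topspace (unit_cube I)" using assms openin_subset by blast
  obtain F \<epsilon> where F: "finite F" "F \<subseteq> I" "\<epsilon> > 0"
    "\<And>p. p \<in> topspace (unit_cube I) \<Longrightarrow> (\<And>i. i \<in> F \<Longrightarrow> \<bar>p i - q i\<bar> < \<epsilon>) \<Longrightarrow> p \<in> W"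
    using unit_cube_box_neighbourhood[OF assms] by blast
  have "cut I F q \<in> W"
    by (rule F(4)[OF cut_in_unit_cube[OF q]]) (use F in \<open>auto simp: cut_def\<close>)
  moreover have "cut I F q \<in> sigma_product I"
    by (rule cut_in_sigma_product[OF q]) (simp add: F(1) countable_finite)
  ultimately show ?thesis by blast
qed

text \<open>The limits and compact hulls found in the cube already lie in the \<Sigma>-product, so
  they serve in the subspace \<open>Z\<close> as well.\<close>

sublocale sequential_core Z "sigma_product I"
proof
  show "Z closure_of sigma_product I = topspace Z"
    unfolding dense_intersects_open
  proof (intro allI impI)
    fix T assume "openin Z T \<and> T \<noteq> {}"
    then obtain W q where "openin (unit_cube I) W" "T = W \<inter> (sigma_product I \<union> E)" "q \<in> W"
      unfolding Z_def openin_subtopology by blast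
    then show "sigma_product I \<inter> T \<noteq> {}" using sigma_product_meets_open[of W q] by blast
  qed
  show "sigma_product I \<subseteq> topspace Z" by (simp add: topspace_Z)
next
  fix \<sigma> :: "nat \<Rightarrow> 'i \<Rightarrow> real" assume \<sigma>: "range \<sigma> \<subseteq> sigma_product I"
  obtain l r where lr: "l \<in> sigma_product I" "strict_mono (r :: nat \<Rightarrow> nat)" "limitin (unit_cube I) (\<sigma> \<circ> r) l sequentially"
    using sigma_product_convergent_subsequence[OF \<sigma>] by blast
  have "\<sigma> n \<in> sigma_product I" for n using \<sigma> by blast
  then have "limitin Z (\<sigma> \<circ> r) l sequentially" using lr by (simp add: Z_def limitin_subtopology)
  then show "\<exists>l \<in> sigma_product I. \<exists>r :: nat \<Rightarrow> nat. strict_mono r \<and> limitin Z (\<sigma> \<circ> r) l sequentially"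
    using lr by blast
next
  fix A assume A: "countable A" "A \<subseteq> sigma_product I"
  obtain S where S: "countable S" "S \<subseteq> I" "A \<subseteq> (\<Pi>\<^sub>E i\<in>I. if i \<in> S then {0..1} else {0})"
    using sigma_product_compact_hull[OF A] by blast
  let ?C = "\<Pi>\<^sub>E i\<in>I. if i \<in> S then {0..1::real} else {0}"
  have C: "?C \<subseteq> sigma_product I" by (rule face_subset_sigma_product[OF S(1)])
  then have "compactin (unit_cube I) ?C"
    using compact_space_face[of S I] sigma_product_subset[of I]
    by (auto simp: compactin_subspace subtopology_unit_cube_face)
  then have "compactin Z ?C" using C by (auto simp: Z_def compactin_subtopology)
  then show "\<exists>C. compactin Z C \<and> C \<subseteq> sigma_product I \<and> A \<subseteq> C" using C S(3) by blast
next
  fix q and R :: "(('i \<Rightarrow> real) \<times> ('i \<Rightarrow> real)) set"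
  assume q: "q \<in> topspace Z" and R: "R \<subseteq> sigma_product I \<times> sigma_product I"
    and meets: "\<forall>W. openin Z W \<and> q \<in> W \<longrightarrow> R \<inter> W \<times> W \<noteq> {}"
  have "R \<inter> W \<times> W \<noteq> {}" if W: "openin (unit_cube I) W" "q \<in> W" for W
  proof -
    have "openin Z (W \<inter> topspace Z)" using W(1) by (auto simp: Z_def openin_subtopology)
    then have "R \<inter> (W \<inter> topspace Z) \<times> (W \<inter> topspace Z) \<noteq> {}" using meets W(2) q by auto
    then show ?thesis by blast
  qed
  then obtain u v l where uvl: "l \<in> sigma_product I" "\<And>n :: nat. (u n, v n) \<in> R"
      "limitin (unit_cube I) u l sequentially" "limitin (unit_cube I) v l sequentially"
    using sigma_product_paired_sequences[OF subsetD[OF topspace_Z_subset q] R] by metis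
  have "u n \<in> sigma_product I" "v n \<in> sigma_product I" for n using subsetD[OF R uvl(2)[of n]] by auto
  then have "limitin Z u l sequentially" "limitin Z v l sequentially"
    using uvl by (simp_all add: Z_def limitin_subtopology)
  then show "\<exists>u v l. (\<forall>n :: nat. (u n, v n) \<in> R) \<and> limitin Z u l sequentially \<and> limitin Z v l sequentially"
    using uvl(2) by blast
qed

text \<open>If the conclusion failed, \<open>K\<close> would contain the restriction of \<open>q\<close> to a set \<open>S\<close> of coordinates with
  \<open>|S| \<le> |L1|\<close> and \<open>L1 \<subseteq> S\<close>: its support is uncountable, yet it vanishes somewhere on \<open>L\<close>.\<close>

lemma compact_isolates_E:
  assumes K: "compactin Z K" and q: "q \<in> E"
  obtains W where "openin Z W" "q \<in> W" "W \<inter> K \<inter> sigma_product I = {}"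
proof -
  let ?C = "topspace (unit_cube I)"
  have qC: "q \<in> ?C" using q E by blast
  have Kc: "compactin (unit_cube I) K" and KZ: "K \<subseteq> sigma_product I \<union> E"
    using K by (auto simp: Z_def compactin_subtopology)
  have closed: "closedin (unit_cube I) K"
    by (rule compactin_imp_closedin[OF Hausdorff_space_unit_cube Kc])
  have "\<exists>F n. finite F \<and> F \<subseteq> I \<and>
      (\<forall>p \<in> K \<inter> sigma_product I. \<not> (\<forall>i\<in>F. \<bar>p i - q i\<bar> < 1 / Suc n))"
  proof (rule ccontr)
    assume contra: "\<not> ?thesis"
    have "\<exists>p. p \<in> K \<inter> sigma_product I \<and> (\<forall>i\<in>F. \<bar>p i - q i\<bar> < 1 / Suc n)"
      if "finite F" "F \<subseteq> I" for F n
      using contra that by meson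
    \<comment> \<open>If no box around \<open>q\<close> avoids the trace of \<open>K\<close>, a
      point of the trace can be chosen for each finite set of coordinates and each
      precision.\<close>
    then obtain g where g: "\<And>F n. finite F \<Longrightarrow> F \<subseteq> I \<Longrightarrow> g F n \<in> K \<inter> sigma_product I"
      and near: "\<And>F n i. finite F \<Longrightarrow> F \<subseteq> I \<Longrightarrow> i \<in> F \<Longrightarrow> \<bar>g F n i - q i\<bar> < 1 / Suc n"
      by metis
    \<comment> \<open>All coordinates used by the points chosen for \<open>F\<close>. Closing
      \<open>L1\<close> under \<open>G\<close> gives an \<open>S\<close> such that the points chosen
      for finite subsets of \<open>S\<close> are supported in \<open>S\<close>.\<close>
    define G where "G F = (\<Union>n. coord_support I (g F n))" for F
    have G: "countable (G F) \<and> G F \<subseteq> I" if "finite F" "F \<subseteq> I" for F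
      using g[OF that] countable_support_UN[of "g F" I]
      by (auto simp: G_def coord_support_def)
    have inf: "infinite L1" by (rule uncountable_infinite[OF L1(2)])
    have L1I: "L1 \<subseteq> I" using L L1(1) by blast
    obtain S where S: "L1 \<subseteq> S" "S \<subseteq> I" "|S| \<le>o |L1|" "\<And>F. finite F \<Longrightarrow> F \<subseteq> S \<Longrightarrow> G F \<subseteq> S"
      by (rule set_closed_under_finitary_operation[OF inf L1I], erule (1) G, rule that)
    define l where "l = cut I S q"
    have lC: "l \<in> ?C" unfolding l_def by (rule cut_in_unit_cube[OF qC])
    have "l \<in> K"
    proof (rule ccontr)
      assume "l \<notin> K"
      then have W: "openin (unit_cube I) (?C - K)" "l \<in> ?C - K" using closed lC by auto
      obtain F \<epsilon> where F: "finite F" "F \<subseteq> I" "\<epsilon> > 0"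
        "\<And>p. p \<in> ?C \<Longrightarrow> (\<And>i. i \<in> F \<Longrightarrow> \<bar>p i - l i\<bar> < \<epsilon>) \<Longrightarrow> p \<in> ?C - K"
        using unit_cube_box_neighbourhood[OF W] by blast
      obtain n where n: "1 / Suc n < \<epsilon>" by (rule nat_approx_posE[OF F(3)])
      \<comment> \<open>This point of \<open>K\<close> approximates \<open>l\<close> on all of
        \<open>F\<close>: on \<open>F \<inter> S\<close> it is close to \<open>q\<close>, which
        agrees with \<open>l\<close> there, and on the rest of \<open>F\<close> both it and
        \<open>l\<close> vanish. Hence the closed set \<open>K\<close> contains
        \<open>l\<close>.\<close>
      let ?p = "g (F \<inter> S) n"
      have FS: "finite (F \<inter> S)" "F \<inter> S \<subseteq> I" "F \<inter> S \<subseteq> S" using F by auto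
      have p: "?p \<in> K" "?p \<in> ?C" using g[OF FS(1,2)] sigma_product_subset[of I] by auto
      have "\<bar>?p i - l i\<bar> < \<epsilon>" if i: "i \<in> F" for i
      proof (cases "i \<in> S")
        case True
        then show ?thesis using near[OF FS(1,2), of i n] i n F(2) by (auto simp: l_def cut_def)
      next
        case False
        then have "i \<notin> coord_support I ?p" using S(4)[OF FS(1,3)] by (auto simp: G_def)
        then show ?thesis using i F(2,3) False by (auto simp: l_def cut_def coord_support_def)
      qed
      then show False using F(4)[OF p(2)] p(1) by blast
    qed
    moreover have "l \<notin> sigma_product I"
    proof -
      have "L1 \<subseteq> coord_support I l"
        using S(1,2) L1(1) E(3)[OF q] by (auto simp: coord_support_def l_def cut_def)
      then show ?thesis using L1(2) countable_subset by (auto simp: sigma_product_def)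
    qed
    \<comment> \<open>Membership in \<open>E\<close> would make \<open>l\<close> equal to
      \<open>1\<close> on \<open>L\<close> and force \<open>L \<subseteq> S\<close>, against
      \<open>|S| \<le>o |L1|\<close> and \<open>|L1| <o |L|\<close>.\<close>
    moreover have "l \<notin> E"
    proof
      assume "l \<in> E"
      then have "L \<subseteq> S" using E(3)[of l] L by (force simp: l_def cut_def split: if_splits)
      then have "|L| \<le>o |L1|" using card_of_mono1 S(3) ordLeq_transitive by blast
      then show False using L1(3) not_ordLess_ordLeq by blast
    qed
    ultimately show False using KZ by blast
  qed
  then obtain F n where F: "finite F" "F \<subseteq> I"
      "\<And>p. p \<in> K \<inter> sigma_product I \<Longrightarrow> \<not> (\<forall>i\<in>F. \<bar>p i - q i\<bar> < 1 / Suc n)" by blast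
  let ?W = "{p \<in> ?C. \<forall>i\<in>F. \<bar>p i - q i\<bar> < 1 / Suc n}"
  show thesis
  proof (rule that)
    show "openin Z (?W \<inter> (sigma_product I \<union> E))"
      using openin_unit_cube_box[OF F(1,2)] unfolding Z_def openin_subtopology by blast
    show "q \<in> ?W \<inter> (sigma_product I \<union> E)" using qC q by simp
    show "?W \<inter> (sigma_product I \<union> E) \<inter> K \<inter> sigma_product I = {}" using F(3) by blast
  qed
qed

section \<open>The weight of \<open>Z\<close> is the number of coordinates\<close>

lemma infinite_I: "infinite I"
  by (rule infinite_super[OF subset_trans[OF L1(1) L] uncountable_infinite[OF L1(2)]])

text \<open>Boxes with rational ends in finitely many coordinates form a base. They are indexed by
  the finite subsets of \<open>I \<times> UNIV\<close>, whose number is that of \<open>I\<close>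
  since \<open>I\<close> is infinite and there are countably many pairs of rationals.\<close>

lemma ex_base_le: "\<exists>\<B>. base_of Z \<B> \<and> |\<B>| \<le>o |I|"
proof -
  define box where "box R = {p \<in> topspace Z. \<forall>(i, a, b)\<in>R. of_rat a < p i \<and> p i < of_rat b}"
    for R :: "('i \<times> rat \<times> rat) set"
  let ?J = "I \<times> (UNIV :: (rat \<times> rat) set)"
  have "base_of Z (box ` Fpow ?J)"
    unfolding base_of_iff
  proof (intro conjI ballI allI impI)
    fix B assume "B \<in> box ` Fpow ?J"
    then obtain R where R: "B = box R" "finite R" "R \<subseteq> ?J" by (auto simp: Fpow_def)
    have "openin Z {p \<in> topspace Z. p i \<in> {of_rat a <..< of_rat b}}" if "(i, a, b) \<in> R" for i a b
      by (rule openin_continuous_map_preimage[OF continuous_map_Z_coordinate]) (use that R in auto)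
    \<comment> \<open>The factor \<open>topspace Z\<close> accounts for an empty \<open>R\<close>,
      whose box is the whole space.\<close>
    then have "openin Z (topspace Z \<inter> \<Inter> ((\<lambda>(i, a, b). {p \<in> topspace Z. p i \<in> {of_rat a <..< of_rat b}}) ` R))"
      using R(2) by (intro openin_Int_Inter) auto
    moreover have "topspace Z \<inter> \<Inter> ((\<lambda>(i, a, b). {p \<in> topspace Z. p i \<in> {of_rat a <..< of_rat b}}) ` R) = B"
      unfolding R(1) box_def by fastforce
    ultimately show "openin Z B" by simp
  next
    fix U x assume "openin Z U \<and> x \<in> U"
    then obtain W where W: "openin (unit_cube I) W" "U = W \<inter> topspace Z" "x \<in> W" "x \<in> topspace Z"
      unfolding topspace_Z unfolding Z_def openin_subtopology by blast
    obtain F \<epsilon> where F: "finite F" "F \<subseteq> I" "\<epsilon> > 0"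
      "\<And>p. p \<in> topspace (unit_cube I) \<Longrightarrow> (\<And>i. i \<in> F \<Longrightarrow> \<bar>p i - x i\<bar> < \<epsilon>) \<Longrightarrow> p \<in> W"
      using unit_cube_box_neighbourhood[OF W(1,3)] by blast
    have "\<forall>i. \<exists>a b :: rat. of_rat a < x i \<and> x i < of_rat b \<and> x i - \<epsilon> < of_rat a \<and> of_rat b < x i + \<epsilon>"
      using rational_between_in_nbhd[OF F(3)] by blast
    then obtain a b where ab: "\<And>i. of_rat (a i) < x i \<and> x i < of_rat (b i) \<and> x i - \<epsilon> < of_rat (a i) \<and> of_rat (b i) < x i + \<epsilon>"
      by metis
    define R where "R = (\<lambda>i. (i, a i, b i)) ` F"
    have "R \<in> Fpow ?J" using F by (auto simp: R_def Fpow_def)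
    moreover have "x \<in> box R" using W(4) ab by (auto simp: box_def R_def)
    moreover have "box R \<subseteq> U"
    proof
      fix p assume p: "p \<in> box R"
      have "\<bar>p i - x i\<bar> < \<epsilon>" if "i \<in> F" for i
      proof -
        have "of_rat (a i) < p i \<and> p i < of_rat (b i)" using p that by (auto simp: box_def R_def)
        then show ?thesis using ab[of i] by linarith
      qed
      moreover have "p \<in> topspace Z" using p by (simp add: box_def)
      ultimately show "p \<in> U" using F(4)[of p] W(2) topspace_Z_subset by blast
    qed
    ultimately show "\<exists>B\<in>box ` Fpow ?J. x \<in> B \<and> B \<subseteq> U" by blast
  qed
  moreover have "|box ` Fpow ?J| \<le>o |I|"
  proof -
    have "|UNIV :: (rat \<times> rat) set| \<le>o |UNIV :: nat set|"
      using countableI_type countable_card_of_nat by blast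
    then have "|UNIV :: (rat \<times> rat) set| \<le>o |I|"
      using infinite_I ordLeq_transitive unfolding infinite_iff_card_of_nat by blast
    then have J: "|?J| =o |I|"
      using card_of_Times_infinite_simps(1)[OF infinite_I] by blast
    have "infinite ?J" using infinite_I infinite_imp_nonempty by (simp add: finite_cartesian_product_iff)
    then have "|Fpow ?J| =o |?J|" by (rule card_of_Fpow_infinite)
    then have "|Fpow ?J| =o |I|" using J ordIso_transitive by blast
    then show ?thesis using card_of_image ordLeq_ordIso_trans by blast
  qed
  ultimately show ?thesis by blast
qed

text \<open>A neighbourhood of the origin of the \<open>\<Sigma>\<close>-product restricts only finitely many coordinates.\<close>

lemma base_ge:
  assumes B: "base_of Z \<B>"
  shows "|I| \<le>o |\<B>|"
proof -
  have Bopen: "openin Z B" if "B \<in> \<B>" for B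
    using B that unfolding base_of_iff by simp
  have Bin: "\<exists>B\<in>\<B>. x \<in> B \<and> B \<subseteq> U" if "openin Z U" "x \<in> U" for U x
    using B that unfolding base_of_iff by simp
  let ?o = "\<lambda>i\<in>I. 0::real"
  have unit: "(\<lambda>j\<in>I. if j = i then 1 else 0) \<in> sigma_product I" if "i \<in> I" for i
  proof -
    have "coord_support I (\<lambda>j\<in>I. if j = i then 1 else 0) \<subseteq> {i}"
      by (auto simp: coord_support_def)
    then have "countable (coord_support I (\<lambda>j\<in>I. if j = i then 1 else 0))"
      by (rule countable_subset) simp
    then show ?thesis by (simp add: sigma_product_def topspace_unit_cube PiE_iff)
  qed
  have o: "?o \<in> sigma_product I"
    by (auto simp: sigma_product_def topspace_unit_cube PiE_iff coord_support_def)
  have "\<forall>i\<in>I. \<exists>B. B \<in> \<B> \<and> ?o \<in> B \<and> B \<subseteq> {p \<in> topspace Z. p i \<in> {..<1}}"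
  proof
    fix i assume that: "i \<in> I"
    have "openin Z {p \<in> topspace Z. p i \<in> {..<1}}"
      by (rule openin_continuous_map_preimage[OF continuous_map_Z_coordinate]) (use that in auto)
    moreover have "?o \<in> {p \<in> topspace Z. p i \<in> {..<1}}" using o that by (simp add: topspace_Z)
    ultimately have "\<exists>B\<in>\<B>. ?o \<in> B \<and> B \<subseteq> {p \<in> topspace Z. p i \<in> {..<1}}" by (rule Bin)
    then show "\<exists>B. B \<in> \<B> \<and> ?o \<in> B \<and> B \<subseteq> {p \<in> topspace Z. p i \<in> {..<1}}"
      by (simp only: Bex_def)
  qed
  from bchoice[OF this] obtain b where
    b: "\<forall>i\<in>I. b i \<in> \<B> \<and> ?o \<in> b i \<and> b i \<subseteq> {p \<in> topspace Z. p i \<in> {..<1}}" ..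
  \<comment> \<open>Were the fibre to contain an \<open>i\<close> outside the finite set
    \<open>F\<close> of coordinates restricted by \<open>B\<close>, the unit vector at
    \<open>i\<close> would lie in \<open>B\<close>, although its coordinate at \<open>i\<close> is
    not below \<open>1\<close>.\<close>
  have fin: "finite {i \<in> I. b i = B}" if "B \<in> b ` I" for B
  proof -
    have "B \<in> \<B>" "?o \<in> B" using that b by blast+
    then have "openin Z B" by (intro Bopen)
    with \<open>?o \<in> B\<close> obtain W where W: "openin (unit_cube I) W" "B = W \<inter> (sigma_product I \<union> E)" "?o \<in> W"
      unfolding Z_def openin_subtopology by blast
    obtain F \<epsilon> where F: "finite F" "F \<subseteq> I" "\<epsilon> > 0"
      "\<And>p. p \<in> topspace (unit_cube I) \<Longrightarrow> (\<And>i. i \<in> F \<Longrightarrow> \<bar>p i - ?o i\<bar> < \<epsilon>) \<Longrightarrow> p \<in> W"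
      using unit_cube_box_neighbourhood[OF W(1,3)] by blast
    have "i \<in> F" if i: "i \<in> I" "b i = B" for i
    proof (rule ccontr)
      assume iF: "i \<notin> F"
      let ?u = "\<lambda>j\<in>I. if j = i then 1 else 0 :: real"
      have "?u \<in> W"
      proof (rule F(4))
        show "?u \<in> topspace (unit_cube I)" by (rule subsetD[OF sigma_product_subset unit[OF i(1)]])
        show "\<bar>?u j - ?o j\<bar> < \<epsilon>" if "j \<in> F" for j using that F(2,3) iF by auto
      qed
      then have "?u \<in> B" using W(2) unit[OF i(1)] by blast
      then have "?u i < 1" using b i by blast
      then show False using i by simp
    qed
    then have "{i \<in> I. b i = B} \<subseteq> F" by blast
    then show ?thesis using F(1) by (rule finite_subset)
  qed
  \<comment> \<open>Finite fibres over the image of \<open>b\<close> make that image infinite and at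
    least as large as \<open>I\<close>.\<close>
  have I: "I = (\<Union>B\<in>b ` I. {i \<in> I. b i = B})" by blast
  have inf: "infinite (b ` I)"
  proof
    assume "finite (b ` I)"
    then have "finite (\<Union>B\<in>b ` I. {i \<in> I. b i = B})" using fin by (rule finite_UN_I)
    then show False using infinite_I by (simp only: I[symmetric])
  qed
  have "|\<Union>B\<in>b ` I. {i \<in> I. b i = B}| \<le>o |b ` I|"
  proof (rule card_of_UNION_ordLeq_infinite[OF inf])
    show "\<forall>B\<in>b ` I. |{i \<in> I. b i = B}| \<le>o |b ` I|"
      by (intro ballI ordLess_imp_ordLeq finite_ordLess_infinite2[OF _ inf] fin)
  qed simp
  then have "|I| \<le>o |b ` I|" by (simp only: I[symmetric])
  also have "|b ` I| \<le>o |\<B>|" by (rule card_of_mono1) (use b in blast)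
  finally show ?thesis .
qed

end

section \<open>The indicator of \<open>E\<close> as a witness against the \<open>kR_space\<close>
  property\<close>

context sigma_extension
begin

lemma not_kR: "\<not> kR_space Z"
proof
  assume kR: "kR_space Z"
  define f :: "('i \<Rightarrow> real) \<Rightarrow> real" where "f = (\<lambda>p. if p \<in> E then 1 else 0)"
  have "k_continuous Z f"
    unfolding k_continuous_def continuous_map_real_iff
  proof (intro allI impI ballI)
    fix K p and \<epsilon> :: real
    assume K: "compactin Z K" and p: "p \<in> topspace (subtopology Z K)" and \<epsilon>: "\<epsilon> > 0"
    \<comment> \<open>On \<open>K\<close> the indicator is locally constant: near a point of
      \<open>E\<close> the compact set has no points of the \<Sigma>-product, and the complement of
      \<open>E\<close> is open.\<close>
    obtain W where W: "openin Z W" "p \<in> W" "\<And>y. y \<in> W \<inter> K \<Longrightarrow> y \<in> E \<longleftrightarrow> p \<in> E"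
    proof (cases "p \<in> E")
      case True
      obtain W where W: "openin Z W" "p \<in> W" "W \<inter> K \<inter> sigma_product I = {}"
        using compact_isolates_E[OF K True] .
      have "y \<in> E" if "y \<in> W \<inter> K" for y
        using W(3) openin_subset[OF W(1)] that unfolding topspace_Z by blast
      then show thesis using W True that by blast
    next
      case False
      have "openin Z (topspace Z - E)" using closedin_E by blast
      then show thesis using False p that[of "topspace Z - E"] by auto
    qed
    have "openin (subtopology Z K) (W \<inter> K)" using W(1) by (auto simp: openin_subtopology)
    moreover have "p \<in> W \<inter> K" using W(2) p by simp
    moreover have "\<bar>f y - f p\<bar> < \<epsilon>" if "y \<in> W \<inter> K" for y using W(3)[OF that] \<epsilon> by (simp add: f_def)
    ultimately show "\<exists>U. openin (subtopology Z K) U \<and> p \<in> U \<and> (\<forall>y\<in>U. \<bar>f y - f p\<bar> < \<epsilon>)" by blast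
  qed
  then have "continuous_map Z euclideanreal f" using kR unfolding kR_space_def by blast
  \<comment> \<open>Continuity would make \<open>E\<close> open, but the disjoint \<Sigma>-product
    is dense and \<open>E\<close> is nonempty.\<close>
  then have "openin Z {p \<in> topspace Z. f p \<in> {1/2<..}}"
    by (rule openin_continuous_map_preimage) simp
  moreover obtain q where "q \<in> E" using E(2) by blast
  then have "q \<in> {p \<in> topspace Z. f p \<in> {1/2<..}}" by (simp add: topspace_Z f_def)
  ultimately obtain p where "p \<in> sigma_product I" "p \<in> {p \<in> topspace Z. f p \<in> {1/2<..}}"
    using meets_open by blast
  then show False using sigma_product_Int_E by (auto simp: f_def split: if_splits)
qed

end

section \<open>Invariance under homeomorphisms\<close>

context
  fixes X :: "'a topology" and Y :: "'b topology" and h g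
  assumes hom: "homeomorphic_maps X Y h g"
begin

lemma homeomorphic_maps_facts:
  shows "continuous_map X Y h" "continuous_map Y X g"
    "\<And>x. x \<in> topspace X \<Longrightarrow> g (h x) = x" "\<And>y. y \<in> topspace Y \<Longrightarrow> h (g y) = y"
    "\<And>x. x \<in> topspace X \<Longrightarrow> h x \<in> topspace Y" "\<And>y. y \<in> topspace Y \<Longrightarrow> g y \<in> topspace X"
  using hom unfolding homeomorphic_maps_def continuous_map_def by auto

lemma kR_space_homeomorphic:
  assumes "kR_space Y"
  shows "kR_space X"
  unfolding kR_space_def
proof (intro allI impI)
  fix f assume f: "k_continuous X f"
  have "k_continuous Y (f \<circ> g)"
    unfolding k_continuous_def
  proof (intro allI impI)
    fix K assume K: "compactin Y K"
    have "continuous_map (subtopology X (g ` K)) euclideanreal f"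
      using f image_compactin[OF K homeomorphic_maps_facts(2)] unfolding k_continuous_def by blast
    moreover have "continuous_map (subtopology Y K) (subtopology X (g ` K)) g"
      using homeomorphic_maps_facts(2)
      by (auto simp: continuous_map_in_subtopology intro: continuous_map_from_subtopology)
    ultimately show "continuous_map (subtopology Y K) euclideanreal (f \<circ> g)"
      using continuous_map_compose by blast
  qed
  then have "continuous_map Y euclideanreal (f \<circ> g)" using assms unfolding kR_space_def by blast
  then have "continuous_map X euclideanreal (f \<circ> g \<circ> h)"
    by (rule continuous_map_compose[OF homeomorphic_maps_facts(1)])
  then show "continuous_map X euclideanreal f"
    by (rule continuous_map_eq) (simp add: homeomorphic_maps_facts)
qed

lemma base_of_homeomorphic:
  assumes "base_of X \<B>"
  shows "base_of Y ((`) h ` \<B>)"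
  unfolding base_of_iff
proof (intro conjI ballI allI impI)
  fix B assume "B \<in> (`) h ` \<B>"
  then obtain B' where "B = h ` B'" "openin X B'" using assms unfolding base_of_iff by auto
  then show "openin Y B"
    using hom homeomorphic_imp_open_map[of X Y h] unfolding homeomorphic_maps_map open_map_def by blast
next
  fix U y assume U: "openin Y U \<and> y \<in> U"
  then have y: "y \<in> topspace Y" using openin_subset by blast
  have "openin X {x \<in> topspace X. h x \<in> U}"
    using U openin_continuous_map_preimage[OF homeomorphic_maps_facts(1)] by blast
  moreover have "g y \<in> {x \<in> topspace X. h x \<in> U}" using y U by (simp add: homeomorphic_maps_facts)
  ultimately have "\<exists>B\<in>\<B>. g y \<in> B \<and> B \<subseteq> {x \<in> topspace X. h x \<in> U}"
    using assms unfolding base_of_iff by simp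
  then obtain B where B: "B \<in> \<B>" "g y \<in> B" "B \<subseteq> {x \<in> topspace X. h x \<in> U}" by blast
  have "y \<in> h ` B" using image_eqI[of y h "g y" B] B(2) y by (simp add: homeomorphic_maps_facts)
  then show "\<exists>B\<in>(`) h ` \<B>. y \<in> B \<and> B \<subseteq> U" using B by blast
qed

text \<open>Transporting the locale makes all its consequences available for the copy of
  \<open>Z\<close> on the candidate type, so they need no separate transfer.\<close>

lemma sequential_core_homeomorphic:
  assumes "sequential_core X D"
  shows "sequential_core Y (h ` D)"
proof -
  interpret X: sequential_core X D by fact
  have gh: "g (h p) = p" "h p \<in> topspace Y" if "p \<in> D" for p
    using that X.core_subset homeomorphic_maps_facts by blast+
  have lim: "limitin Y (\<lambda>n. h (u n)) (h l) sequentially" if "limitin X u l sequentially" for u l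
    using continuous_map_limit[OF homeomorphic_maps_facts(1) that] by (simp add: comp_def)
  show ?thesis
  proof
    show "Y closure_of (h ` D) = topspace Y"
      unfolding dense_intersects_open
    proof (intro allI impI)
      fix T assume T: "openin Y T \<and> T \<noteq> {}"
      then obtain y where y: "y \<in> T" "y \<in> topspace Y" using openin_subset by blast
      have "openin X {x \<in> topspace X. h x \<in> T}"
        using T openin_continuous_map_preimage[OF homeomorphic_maps_facts(1)] by blast
      moreover have "g y \<in> {x \<in> topspace X. h x \<in> T}" using y by (simp add: homeomorphic_maps_facts)
      ultimately obtain p where "p \<in> D" "h p \<in> T" using X.meets_open by blast
      then show "h ` D \<inter> T \<noteq> {}" by blast
    qed
    show "h ` D \<subseteq> topspace Y" using gh by blast
  next
    fix \<sigma> :: "nat \<Rightarrow> 'b" assume \<sigma>: "range \<sigma> \<subseteq> h ` D"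
    have \<sigma>n: "\<sigma> n \<in> h ` D" for n using \<sigma> by blast
    have hg: "h (g (\<sigma> n)) = \<sigma> n \<and> g (\<sigma> n) \<in> D" for n
      using \<sigma>n[of n] gh(1) by auto
    then have "range (g \<circ> \<sigma>) \<subseteq> D" by auto
    then obtain l r where lr: "l \<in> D" "strict_mono (r :: nat \<Rightarrow> nat)" "limitin X (g \<circ> \<sigma> \<circ> r) l sequentially"
      using X.convergent_subsequence by blast
    have "limitin Y (\<sigma> \<circ> r) (h l) sequentially" using lim[OF lr(3)] by (simp add: hg comp_def)
    then show "\<exists>l\<in>h ` D. \<exists>r :: nat \<Rightarrow> nat. strict_mono r \<and> limitin Y (\<sigma> \<circ> r) l sequentially"
      using lr by blast
  next
    fix A assume A: "countable A" "A \<subseteq> h ` D"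
    have "g ` A \<subseteq> D" using A(2) gh by auto
    then obtain C where C: "compactin X C" "C \<subseteq> D" "g ` A \<subseteq> C"
      using X.countable_compact_hull[of "g ` A"] A(1) by blast
    have "compactin Y (h ` C)" by (rule image_compactin[OF C(1) homeomorphic_maps_facts(1)])
    moreover have "A \<subseteq> h ` C"
    proof
      fix a assume "a \<in> A"
      then have "g a \<in> C" "h (g a) = a" using A(2) C(3) gh by auto
      then show "a \<in> h ` C" using image_eqI[of a h "g a" C] by simp
    qed
    ultimately show "\<exists>C. compactin Y C \<and> C \<subseteq> h ` D \<and> A \<subseteq> C" using C(2) by blast
  next
    fix q and R :: "('b \<times> 'b) set"
    assume q: "q \<in> topspace Y" and R: "R \<subseteq> h ` D \<times> h ` D"
      and meets: "\<forall>W. openin Y W \<and> q \<in> W \<longrightarrow> R \<inter> W \<times> W \<noteq> {}"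
    define R' where "R' = {(a, b). a \<in> D \<and> b \<in> D \<and> (h a, h b) \<in> R}"
    have "R' \<inter> W \<times> W \<noteq> {}" if W: "openin X W" "g q \<in> W" for W
    proof -
      have "openin Y {y \<in> topspace Y. g y \<in> W}"
        by (rule openin_continuous_map_preimage[OF homeomorphic_maps_facts(2) W(1)])
      then obtain a b where ab: "(a, b) \<in> R" "g a \<in> W" "g b \<in> W"
        using meets q W(2) by blast
      then obtain c d where "a = h c" "b = h d" "c \<in> D" "d \<in> D" using R by blast
      then have "(c, d) \<in> R' \<inter> W \<times> W" using ab gh by (simp add: R'_def)
      then show ?thesis by blast
    qed
    moreover have "R' \<subseteq> D \<times> D" by (auto simp: R'_def)
    ultimately obtain u v l where uv: "\<And>n :: nat. (u n, v n) \<in> R'"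
        "limitin X u l sequentially" "limitin X v l sequentially"
      using X.paired_sequences[OF homeomorphic_maps_facts(6)[OF q], of R'] by blast
    then have "\<forall>n. (h (u n), h (v n)) \<in> R" by (simp add: R'_def)
    then show "\<exists>u v l. (\<forall>n :: nat. (u n, v n) \<in> R) \<and> limitin Y u l sequentially \<and> limitin Y v l sequentially"
      using lim[OF uv(2)] lim[OF uv(3)]
      by (intro exI[of _ "\<lambda>n. h (u n)"] exI[of _ "\<lambda>n. h (v n)"] exI[of _ "h l"] conjI)
  qed
qed

end

section \<open>The Stone--\v{C}ech compactification\<close>

lemma stone_cech_cube_eq: "stone_cech_cube X = unit_cube (unit_functions X)"
  by (simp add: stone_cech_cube_def unit_cube_def)

definition stone_cech_map :: "'a topology \<Rightarrow> 'a \<Rightarrow> ('a \<Rightarrow> real) \<Rightarrow> real" where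
  "stone_cech_map X x = (\<lambda>f\<in>unit_functions X. f x)"

lemma stone_cech_eq:
  "stone_cech X = subtopology (unit_cube (unit_functions X))
     (unit_cube (unit_functions X) closure_of (stone_cech_map X ` topspace X))"
  unfolding stone_cech_def stone_cech_cube_eq stone_cech_map_def ..

lemma topspace_stone_cech:
  "topspace (stone_cech X) = unit_cube (unit_functions X) closure_of (stone_cech_map X ` topspace X)"
  using closure_of_subset_topspace by (fastforce simp: stone_cech_eq)

lemma compact_space_stone_cech: "compact_space (stone_cech X)"
  unfolding stone_cech_eq
  by (intro compact_space_subtopology closedin_compact_space compact_space_unit_cube closedin_closure_of)

lemma Hausdorff_space_stone_cech: "Hausdorff_space (stone_cech X)"
  by (simp add: stone_cech_eq Hausdorff_space_subtopology Hausdorff_space_unit_cube)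

lemma completely_regular_space_stone_cech: "completely_regular_space (stone_cech X)"
  by (simp add: stone_cech_eq completely_regular_space_subtopology completely_regular_space_unit_cube)

lemma stone_cech_map_image_subset:
  "stone_cech_map X ` topspace X \<subseteq> topspace (unit_cube (unit_functions X))"
proof
  fix b assume "b \<in> stone_cech_map X ` topspace X"
  then obtain x where x: "x \<in> topspace X" "b = stone_cech_map X x" by blast
  have "f x \<in> {0..1}" if "f \<in> unit_functions X" for f
    using that x(1) unfolding unit_functions_def continuous_map_in_subtopology by blast
  then show "b \<in> topspace (unit_cube (unit_functions X))"
    by (simp add: x(2) stone_cech_map_def topspace_unit_cube)
qed

lemma embedding_map_stone_cech_map:
  assumes "tychonoff_space X"
  shows "embedding_map X (stone_cech X) (stone_cech_map X)"
proof -
  \<comment> \<open>Identifies the index set of the Stone-Cech cube with the function space used in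
    the general cube embedding of completely regular spaces.\<close>
  have "mspace (submetric (cfunspace X euclidean_metric) {f. f \<in> topspace X \<rightarrow> {0..1}}) = unit_functions X"
  proof -
    have "bounded (f ` topspace X)" if "f \<in> topspace X \<rightarrow> {0..1::real}" for f
      by (rule bounded_subset[OF bounded_closed_interval[of 0 1]]) (use that in auto)
    then show ?thesis
      unfolding unit_functions_def continuous_map_in_subtopology by (simp add: set_eq_iff) blast
  qed
  then have emb: "embedding_map X (unit_cube (unit_functions X)) (stone_cech_map X)"
    using completely_regular_space_cube_embedding_explicit[of X] assms
    unfolding tychonoff_space_def unit_cube_def stone_cech_map_def by simp
  show ?thesis
    unfolding stone_cech_eq embedding_map_in_subtopology
    by (rule conjI[OF emb closure_of_subset[OF stone_cech_map_image_subset]])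
qed

text \<open>Rescaled affinely into \<open>[0,1]\<close>, the function becomes an index
  \<open>u\<close> of the cube; the extension is the coordinate projection at \<open>u\<close>,
  scaled back.\<close>

lemma bounded_extends_to_stone_cech:
  assumes f: "continuous_map X euclideanreal f" and "bounded (f ` topspace X)"
  obtains F where "continuous_map (stone_cech X) euclideanreal F"
    "\<And>x. x \<in> topspace X \<Longrightarrow> F (stone_cech_map X x) = f x"
proof -
  obtain c where c: "c > 0" "\<And>x. x \<in> topspace X \<Longrightarrow> \<bar>f x\<bar> \<le> c"
    using assms(2) unfolding bounded_pos by auto
  define u where "u = (\<lambda>x\<in>topspace X. (f x + c) / (2 * c))"
  have "continuous_map X euclideanreal (\<lambda>x. (f x + c) / (2 * c))"
    by (intro continuous_intros f) (use c in auto)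
  then have "continuous_map X euclideanreal u"
    by (rule continuous_map_eq) (simp add: u_def)
  moreover have "u x \<in> {0..1}" if "x \<in> topspace X" for x
    using c(1) c(2)[OF that] that by (simp add: u_def field_simps abs_le_iff)
  ultimately have u: "u \<in> unit_functions X"
    by (auto simp: unit_functions_def continuous_map_in_subtopology u_def)
  show thesis
  proof (rule that)
    show "continuous_map (stone_cech X) euclideanreal (\<lambda>b. 2 * c * b u - c)"
      unfolding stone_cech_eq
      by (intro continuous_intros continuous_map_from_subtopology continuous_map_coordinate u)
    show "2 * c * stone_cech_map X x u - c = f x" if "x \<in> topspace X" for x
      using that u c(1) by (simp add: stone_cech_map_def u_def field_simps)
  qed
qed

text \<open>In a regular space the interiors of closures of subsets of a fixed dense set form a base.\<close>

lemma ex_small_base_stone_cech: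
  fixes X :: "'a topology"
  shows "\<exists>\<B>. base_of (stone_cech X) \<B> \<and> |\<B>| \<le>o |UNIV :: 'a set set|"
proof -
  let ?B = "stone_cech X"
  define D where "D = stone_cech_map X ` topspace X"
  have Dsub: "D \<subseteq> topspace (unit_cube (unit_functions X))"
    unfolding D_def by (rule stone_cech_map_image_subset)
  have dense: "?B closure_of D = topspace ?B"
  proof -
    have "D \<subseteq> unit_cube (unit_functions X) closure_of D" using closure_of_subset[OF Dsub] .
    then have "?B closure_of D = unit_cube (unit_functions X) closure_of D"
      unfolding stone_cech_eq D_def[symmetric]
      by (simp add: closure_of_subtopology inf.absorb_iff2 inf.absorb1)
    then show ?thesis by (simp add: topspace_stone_cech D_def)
  qed
  have reg: "regular_space ?B"
    by (simp add: compact_Hausdorff_imp_regular_space compact_space_stone_cech Hausdorff_space_stone_cech)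
  \<comment> \<open>Indexing by the subsets of the carrier of \<open>X\<close> bounds the number of
    members by the power set.\<close>
  define \<B> where "\<B> = (\<lambda>A. ?B interior_of (?B closure_of (stone_cech_map X ` A))) ` Pow (topspace X)"
  have "base_of ?B \<B>"
    unfolding base_of_iff
  proof (intro conjI ballI allI impI)
    fix B assume "B \<in> \<B>" then show "openin ?B B" by (auto simp: \<B>_def)
  next
    fix W x assume Wx: "openin ?B W \<and> x \<in> W"
    then have "closedin ?B (topspace ?B - W) \<and> x \<in> topspace ?B - (topspace ?B - W)"
      using openin_subset[of ?B W] by auto
    then have "\<exists>U. openin ?B U \<and> x \<in> U \<and> disjnt (topspace ?B - W) (?B closure_of U)"
      by (rule reg[unfolded regular_space, rule_format])
    then obtain U where U: "openin ?B U" "x \<in> U" "disjnt (topspace ?B - W) (?B closure_of U)"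
      by blast
    have clU: "?B closure_of U \<subseteq> W"
      using U(3) closure_of_subset_topspace[of ?B U] by (auto simp: disjnt_def)
    define A where "A = {a \<in> topspace X. stone_cech_map X a \<in> U}"
    have AU: "stone_cech_map X ` A = U \<inter> D" by (auto simp: A_def D_def)
    have "U \<subseteq> ?B closure_of D" using dense openin_subset[OF U(1)] by simp
    \<comment> \<open>For open \<open>U\<close> and dense \<open>D\<close>, the trace
      \<open>U \<inter> D\<close> has the same closure as \<open>U\<close>, so \<open>A\<close>
      recovers the closure of \<open>U\<close>.\<close>
    then have "?B closure_of (U \<inter> D) = ?B closure_of U"
      by (intro closure_of_openin_Int_superset conjI U(1))
    then have eq: "?B closure_of (stone_cech_map X ` A) = ?B closure_of U" by (simp add: AU)
    show "\<exists>B\<in>\<B>. x \<in> B \<and> B \<subseteq> W"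
    proof (intro bexI conjI)
      show "?B interior_of (?B closure_of (stone_cech_map X ` A)) \<in> \<B>"
        unfolding \<B>_def by (rule imageI) (auto simp: A_def)
      have "U \<subseteq> ?B interior_of (?B closure_of U)"
        by (rule interior_of_maximal[OF closure_of_subset[OF openin_subset[OF U(1)]] U(1)])
      then show "x \<in> ?B interior_of (?B closure_of (stone_cech_map X ` A))"
        unfolding eq by (rule subsetD[OF _ U(2)])
      show "?B interior_of (?B closure_of (stone_cech_map X ` A)) \<subseteq> W"
        unfolding eq by (rule subset_trans[OF interior_of_subset clU])
    qed
  qed
  moreover have "|\<B>| \<le>o |UNIV :: 'a set set|"
  proof -
    have "|\<B>| \<le>o |Pow (topspace X)|" unfolding \<B>_def by (rule card_of_image)
    moreover have "|Pow (topspace X)| \<le>o |UNIV :: 'a set set|" by (rule card_of_mono1) simp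
    ultimately show ?thesis by (rule ordLeq_transitive)
  qed
  ultimately show ?thesis by blast
qed

text \<open>As in Urysohn's metrization argument, one function is chosen for each pair
  \<open>(U, V)\<close> of basic sets that admits a function equal to \<open>0\<close> on
  \<open>U\<close> and to \<open>1\<close> outside \<open>V\<close>. The index set
  \<open>\<B> \<times> \<B>\<close> keeps the number of functions under control.\<close>

lemma base_separating_functions:
  assumes cr: "completely_regular_space B" and haus: "Hausdorff_space B" and base: "base_of B \<B>"
  obtains \<phi> where "\<And>j. continuous_map B (top_of_set {0..1::real}) (\<phi> j)"
    "\<And>x y. x \<in> topspace B \<Longrightarrow> y \<in> topspace B \<Longrightarrow> x \<noteq> y \<Longrightarrow> \<exists>j\<in>\<B> \<times> \<B>. \<phi> j x \<noteq> \<phi> j y"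
proof -
  define good where "good j f \<longleftrightarrow> continuous_map B (top_of_set {0..1::real}) f \<and>
      (\<forall>x\<in>fst j. f x = 0) \<and> (\<forall>x\<in>topspace B - snd j. f x = 1)" for j f
  \<comment> \<open>Pairs that cannot be separated receive the constant \<open>0\<close>, so that
    every index still names a continuous function.\<close>
  define \<phi> where "\<phi> j = (if \<exists>f. good j f then SOME f. good j f else (\<lambda>_. 0))" for j
  have good: "good j (\<phi> j)" if "good j f" for j f
    unfolding \<phi>_def using that someI[of "good j" f] by auto
  have basis: "\<exists>V\<in>\<B>. x \<in> V \<and> V \<subseteq> U" if "openin B U" "x \<in> U" for U x
    using base that unfolding base_of_iff by simp
  show thesis
  proof (rule that)
    show "continuous_map B (top_of_set {0..1::real}) (\<phi> j)" for j
    proof (cases "\<exists>f. good j f")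
      case True
      then have "good j (\<phi> j)" using good by blast
      then show ?thesis by (simp add: good_def)
    next
      case False
      then show ?thesis by (simp add: \<phi>_def)
    qed
    fix x y assume x: "x \<in> topspace B" and y: "y \<in> topspace B" and "x \<noteq> y"
    have "openin B (topspace B - {y})"
      using closedin_Hausdorff_singleton[OF haus y] by blast
    then obtain V where V: "V \<in> \<B>" "x \<in> V" "V \<subseteq> topspace B - {y}" using basis x \<open>x \<noteq> y\<close> by blast
    have "openin B V" using base V(1) unfolding base_of_iff by blast
    then have "closedin B (topspace B - V)" by blast
    then obtain f where f: "continuous_map B (top_of_set {0..1::real}) f" "f x = 0" "f ` (topspace B - V) \<subseteq> {1}"
      using cr x V(2) unfolding completely_regular_space_def by blast
    have fr: "continuous_map B euclideanreal f" using f(1) by (simp add: continuous_map_in_subtopology)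
    have "openin B {z \<in> topspace B. f z \<in> {..<1/2}}"
      by (rule openin_continuous_map_preimage[OF fr]) simp
    moreover have "x \<in> {z \<in> topspace B. f z \<in> {..<1/2}}" using x f(2) by simp
    ultimately obtain U where U: "U \<in> \<B>" "x \<in> U" "U \<subseteq> {z \<in> topspace B. f z \<in> {..<1/2}}"
      using basis by blast
    have f01: "f z \<in> {0..1}" if "z \<in> topspace B" for z
      using f(1) that by (auto simp: continuous_map_in_subtopology)
    \<comment> \<open>Truncation turns the vanishing of \<open>f\<close> at \<open>x\<close> into
      vanishing on all of \<open>U\<close>, where \<open>f\<close> is below \<open>1/2\<close>, and
      keeps the value \<open>1\<close> outside \<open>V\<close>.\<close>
    have "good (U, V) (\<lambda>z. max 0 (2 * f z - 1))"
      unfolding good_def continuous_map_in_subtopology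
    proof (intro conjI ballI)
      show "continuous_map B euclideanreal (\<lambda>z. max 0 (2 * f z - 1))"
        by (intro continuous_intros fr)
      show "(\<lambda>z. max 0 (2 * f z - 1)) \<in> topspace B \<rightarrow> {0..1}" using f01 by fastforce
    qed (use U V f(3) in auto)
    from good[OF this] have "good (U, V) (\<phi> (U, V))" .
    then have "\<phi> (U, V) x = 0" "\<phi> (U, V) y = 1" using U(2) V(3) y by (auto simp: good_def)
    then show "\<exists>j\<in>\<B> \<times> \<B>. \<phi> j x \<noteq> \<phi> j y" using U(1) V(1) by (intro bexI[of _ "(U, V)"]) auto
  qed
qed

section \<open>Cardinalities and the candidate type\<close>

lemma card_of_UNIV_set_mono:
  assumes "|UNIV :: 'x set| \<le>o |UNIV :: 'y set|"
  shows "|UNIV :: 'x set set| \<le>o |UNIV :: 'y set set|"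
proof -
  obtain f :: "'x \<Rightarrow> 'y" where "inj f" using assms card_of_ordLeq[of "UNIV :: 'x set" "UNIV :: 'y set"] by auto
  then have "inj (image f)" by (simp add: inj_def inj_image_eq_iff)
  then show ?thesis using card_of_ordLeq[of "UNIV :: 'x set set" "UNIV :: 'y set set"] by auto
qed

lemma cardSuc_le_card_of_UNIV_set:
  assumes "Card_order r" "r \<le>o |UNIV :: 'x set|"
  shows "cardSuc r \<le>o |UNIV :: 'x set set|"
proof (rule cardSuc_least[OF assms(1) card_of_Card_order])
  have "|UNIV :: 'x set| <o |UNIV :: 'x set set|" using card_of_Pow[of "UNIV :: 'x set"] by simp
  then show "r <o |UNIV :: 'x set set|" using assms(2) ordLeq_ordLess_trans by blast
qed

lemma Card_order_aleph2: "Card_order aleph2"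
  unfolding aleph2_def by (intro cardSuc_Card_order natLeq_Card_order)

text \<open>Each successor is bounded by a power set, so two power sets over the naturals suffice;
  an infinite type contains the naturals.\<close>

lemma aleph2_le:
  assumes "infinite (UNIV :: 'a set)"
  shows "aleph2 \<le>o |UNIV :: 'a set set set|"
proof -
  have "|UNIV :: nat set| \<le>o |UNIV :: 'a set|" using assms by (simp add: infinite_iff_card_of_nat)
  then have mono: "|UNIV :: nat set set set| \<le>o |UNIV :: 'a set set set|"
    by (intro card_of_UNIV_set_mono)
  have "natLeq \<le>o |UNIV :: nat set|" using card_of_nat ordIso_symmetric ordIso_imp_ordLeq by blast
  then have "cardSuc natLeq \<le>o |UNIV :: nat set set|"
    by (rule cardSuc_le_card_of_UNIV_set[OF natLeq_Card_order])
  then have "aleph2 \<le>o |UNIV :: nat set set set|"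
    unfolding aleph2_def
    by (rule cardSuc_le_card_of_UNIV_set[OF cardSuc_Card_order[OF natLeq_Card_order]])
  then show ?thesis using mono ordLeq_transitive by blast
qed

text \<open>An injective copy of the field of \<open>cardSuc natLeq\<close> provides a subset of the
  first uncountable cardinality.\<close>

lemma ex_intermediate_subset_aleph2:
  obtains L1 where "L1 \<subseteq> Field aleph2" "uncountable L1" "|L1| <o |Field aleph2|"
proof -
  let ?w = "cardSuc natLeq"
  have w: "Card_order ?w" by (rule cardSuc_Card_order[OF natLeq_Card_order])
  have less: "?w <o aleph2" unfolding aleph2_def by (rule cardSuc_greater[OF w])
  have F: "|Field aleph2| =o aleph2" by (rule card_of_Field_ordIso[OF Card_order_aleph2])
  have Fw: "|Field ?w| =o ?w" by (rule card_of_Field_ordIso[OF w])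
  have lt: "|Field ?w| <o |Field aleph2|"
    using ordIso_ordLess_trans[OF Fw ordLess_ordIso_trans[OF less ordIso_symmetric[OF F]]] .
  then obtain f where f: "inj_on f (Field ?w)" "f ` Field ?w \<subseteq> Field aleph2"
    using ordLess_imp_ordLeq card_of_ordLeq by metis
  have iso: "|f ` Field ?w| =o |Field ?w|"
    using card_of_ordIsoI[OF inj_on_imp_bij_betw[OF f(1)]] ordIso_symmetric by blast
  show thesis
  proof (rule that[OF f(2)])
    show "uncountable (f ` Field ?w)"
    proof
      assume "countable (f ` Field ?w)"
      then have "|f ` Field ?w| \<le>o natLeq" by (simp add: countable_card_le_natLeq)
      then have "?w \<le>o natLeq"
        using ordIso_ordLeq_trans[OF ordIso_symmetric[OF ordIso_transitive[OF iso Fw]]] by blast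
      then show False using cardSuc_greater[OF natLeq_Card_order] not_ordLess_ordLeq by blast
    qed
    show "|f ` Field ?w| <o |Field aleph2|" by (rule ordIso_ordLess_trans[OF iso lt])
  qed
qed

lemma real_eqI_rat:
  fixes x y :: real
  assumes "\<And>q. of_rat q < x \<longleftrightarrow> of_rat q < y"
  shows "x = y"
proof (rule ccontr)
  assume "x \<noteq> y"
  then consider "x < y" | "y < x" by linarith
  then show False
  proof cases
    case 1
    then obtain q where "x < of_rat q" "of_rat q < y" using of_rat_dense by blast
    then show False using assms[of q] by linarith
  next
    case 2
    then obtain q where "y < of_rat q" "of_rat q < x" using of_rat_dense by blast
    then show False using assms[of q] by linarith
  qed
qed

text \<open>A real function \<open>f\<close> is encoded by its rational subgraph \<open>{(i, q). q < f i}\<close>.\<close>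

lemma real_functions_inject:
  fixes I :: "'i set"
  assumes I: "|I| \<le>o |UNIV :: 'n set|" and inf: "infinite (UNIV :: 'n set)"
  obtains h :: "('i \<Rightarrow> real) \<Rightarrow> 'n set" where "inj_on h (extensional I)"
proof -
  have "|UNIV :: rat set| \<le>o |UNIV :: nat set|"
    using countableI_type countable_card_of_nat by blast
  then have "|UNIV :: rat set| \<le>o |UNIV :: 'n set|"
    using inf ordLeq_transitive unfolding infinite_iff_card_of_nat by blast
  then have "|I \<times> (UNIV :: rat set)| \<le>o |UNIV :: 'n set|"
    using card_of_Times_ordLeq_infinite_Field[of "|UNIV :: 'n set|"] I inf by simp
  then obtain \<kappa> :: "'i \<times> rat \<Rightarrow> 'n" where \<kappa>: "inj_on \<kappa> (I \<times> UNIV)"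
    using card_of_ordLeq[of "I \<times> (UNIV :: rat set)" "UNIV :: 'n set"] by auto
  define G where "G f = {(i, q). i \<in> I \<and> of_rat q < f i}" for f :: "'i \<Rightarrow> real"
  have "inj_on (\<lambda>f. \<kappa> ` G f) (extensional I)"
  proof (rule inj_onI)
    fix f g :: "'i \<Rightarrow> real"
    assume f: "f \<in> extensional I" and g: "g \<in> extensional I" and eq: "\<kappa> ` G f = \<kappa> ` G g"
    have "G f \<subseteq> I \<times> UNIV" "G g \<subseteq> I \<times> UNIV" by (auto simp: G_def)
    then have Geq: "G f = G g" using eq inj_on_image_eq_iff[OF \<kappa>] by blast
    show "f = g"
    proof (rule extensionalityI[OF f g])
      fix i assume i: "i \<in> I"
      have "of_rat q < f i \<longleftrightarrow> of_rat q < g i" for q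
      proof -
        have "(i, q) \<in> G f \<longleftrightarrow> (i, q) \<in> G g" by (simp only: Geq)
        then show ?thesis using i by (simp add: G_def)
      qed
      then show "f i = g i" by (rule real_eqI_rat)
    qed
  qed
  then show thesis by (rule that)
qed

text \<open>The copy carries the topology pulled back along the inverse of \<open>h\<close>; this is
  how the space reaches the candidate type.\<close>

lemma homeomorphic_copy:
  assumes "inj_on h (topspace X)"
  obtains Y g where "homeomorphic_maps X Y h g"
proof -
  define g where "g = inv_into (topspace X) h"
  define Y where "Y = pullback_topology (h ` topspace X) g X"
  have gh: "g (h x) = x" if "x \<in> topspace X" for x
    using that assms by (simp add: g_def)
  have "continuous_map X Y h"
    unfolding Y_def
  proof (rule continuous_map_pullback')
    show "continuous_map X X (g \<circ> h)"
      by (rule continuous_map_eq[OF continuous_map_id]) (simp add: gh)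
  qed blast
  moreover have "continuous_map Y X (id \<circ> g)"
    unfolding Y_def by (rule continuous_map_pullback[OF continuous_map_id])
  then have "continuous_map Y X g" by simp
  moreover have "h (g y) = y" if "y \<in> topspace Y" for y
    using that by (auto simp: Y_def topspace_pullback_topology gh)
  ultimately have "homeomorphic_maps X Y h g"
    unfolding homeomorphic_maps_def using gh by blast
  then show thesis by (rule that)
qed

lemma homeomorphic_map_imp_embedding_map:
  "homeomorphic_map X Y h \<Longrightarrow> embedding_map X Y h"
  by (simp add: embedding_map_def homeomorphic_imp_surjective_map)

text \<open>Absorption for the shape of the coordinate set used below. If \<open>A\<close> is at
  most \<open>r\<close>, the whole sum collapses to \<open>r\<close>; otherwise \<open>A\<close> is
  infinite and absorbs both its square and \<open>r\<close>.\<close>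

lemma is_max_card_square_sum:
  fixes t :: "'t rel" and A :: "'x set" and r :: "'r rel"
  assumes t: "t =o |(A \<times> A) <+> Field r|" and r: "Card_order r" "infinite (Field r)"
  shows "is_max_card t |A| r"
proof -
  let ?I = "(A \<times> A) <+> Field r"
  have F: "|Field r| =o r" by (rule card_of_Field_ordIso[OF r(1)])
  have tI: "|?I| =o t" by (rule ordIso_symmetric[OF t])
  have "|A| \<le>o |A \<times> A|"
    by (cases "A = {}") (auto simp: card_of_Times1 card_of_empty)
  then have "|A| \<le>o |?I|" using card_of_Plus1 ordLeq_transitive by blast
  then have le1: "|A| \<le>o t" using tI ordLeq_ordIso_trans by blast
  have "|Field r| \<le>o |?I|" by (rule card_of_Plus2)
  then have le2: "r \<le>o t" using F tI ordIso_ordLeq_trans ordLeq_ordIso_trans ordIso_symmetric by metis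
  have "t =o |A| \<or> t =o r"
  proof (cases "|A| \<le>o |Field r|")
    case True
    have "|A \<times> A| \<le>o |Field r|"
      using card_of_Times_ordLeq_infinite_Field[of "|Field r|"] True r(2) by simp
    then have "|?I| \<le>o |Field r|"
      using card_of_Plus_ordLeq_infinite_Field[of "|Field r|"] r(2) by simp
    then have "t \<le>o r" using F t ordIso_ordLeq_trans ordLeq_ordIso_trans by metis
    then show ?thesis using le2 by (simp add: ordIso_iff_ordLeq)
  next
    case False
    then have lt: "|Field r| \<le>o |A|"
      using ordLeq_total[OF card_of_Well_order card_of_Well_order] by blast
    then have inf: "infinite A" using r(2) card_of_ordLeq_infinite by blast
    have "|A \<times> A| \<le>o |A|"
      by (rule card_of_Times_ordLeq_infinite_Field) (use inf in simp_all)
    then have "|?I| \<le>o |A|"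
      using card_of_Plus_ordLeq_infinite_Field[of "|A|"] lt inf by simp
    then have "t \<le>o |A|" using t ordIso_ordLeq_trans by blast
    then show ?thesis using le1 by (simp add: ordIso_iff_ordLeq)
  qed
  then show ?thesis using le1 le2 by (simp add: is_max_card_def)
qed

lemma is_max_card_le:
  assumes "is_max_card t r s" "r \<le>o u" "s \<le>o u"
  shows "t \<le>o u"
proof -
  have "t =o r \<or> t =o s" using assms(1) by (simp add: is_max_card_def)
  then show ?thesis
    using ordIso_ordLeq_trans[OF _ assms(2)] ordIso_ordLeq_trans[OF _ assms(3)] by blast
qed

text \<open>A bounded function on the image of \<open>X\<close> extends over the Stone-Cech
  compactification, whose image under \<open>G\<close> is compact and hence closed in the normal
  cube. Tietze extends it over the cube, and \<open>g\<close> pulls it back to \<open>Y\<close>;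
  \<open>gT\<close> makes the result agree with \<open>f\<close>.\<close>

lemma C_star_embedding_via_cube:
  assumes emb: "embedding_map X Y T"
    and G: "embedding_map (stone_cech X) (unit_cube I) G"
    and g: "continuous_map Y (unit_cube I) g"
    and gT: "\<And>x. x \<in> topspace X \<Longrightarrow> g (T x) = G (stone_cech_map X x)"
  shows "C_star_embedding X Y T"
  unfolding C_star_embedding_def
proof (intro conjI emb allI impI)
  fix f assume f: "continuous_map (subtopology Y (T ` topspace X)) euclideanreal f \<and> bounded (f ` (T ` topspace X))"
  have "continuous_map X (subtopology Y (T ` topspace X)) T"
    using emb unfolding embedding_map_def by (rule homeomorphic_imp_continuous_map)
  then have fT: "continuous_map X euclideanreal (f \<circ> T)" using f continuous_map_compose by blast
  have bd: "bounded ((f \<circ> T) ` topspace X)" using f by (simp add: image_comp)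
  obtain F where F: "continuous_map (stone_cech X) euclideanreal F"
      "\<And>x. x \<in> topspace X \<Longrightarrow> F (stone_cech_map X x) = (f \<circ> T) x"
    by (rule bounded_extends_to_stone_cech[OF fT bd], rule that)
  let ?B = "stone_cech X" and ?C = "unit_cube I"
  obtain G' where G': "homeomorphic_maps ?B (subtopology ?C (G ` topspace ?B)) G G'"
    using G unfolding embedding_map_def homeomorphic_map_maps by blast
  have "compactin ?C (G ` topspace ?B)"
    by (rule image_compactin[where X = ?B])
      (use G' compact_space_stone_cech in \<open>auto simp: compact_space_def homeomorphic_maps_def continuous_map_in_subtopology\<close>)
  then have closed: "closedin ?C (G ` topspace ?B)"
    by (rule compactin_imp_closedin[OF Hausdorff_space_unit_cube])
  have cont: "continuous_map (subtopology ?C (G ` topspace ?B)) euclideanreal (F \<circ> G')"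
    using G' F(1) continuous_map_compose unfolding homeomorphic_maps_def by blast
  obtain \<Phi> where \<Phi>: "continuous_map ?C euclideanreal \<Phi>" "\<And>c. c \<in> G ` topspace ?B \<Longrightarrow> \<Phi> c = (F \<circ> G') c"
    by (rule Tietze_extension_realinterval[OF normal_space_unit_cube closed is_interval_univ _ cont]) auto
  have "\<Phi> (g (T x)) = f (T x)" if x: "x \<in> topspace X" for x
  proof -
    have b: "stone_cech_map X x \<in> topspace ?B"
      using x closure_of_subset[OF stone_cech_map_image_subset[of X]] unfolding topspace_stone_cech by blast
    then have "G' (G (stone_cech_map X x)) = stone_cech_map X x"
      using G' by (simp add: homeomorphic_maps_def)
    then show ?thesis using gT[OF x] \<Phi>(2)[of "G (stone_cech_map X x)"] F(2)[OF x] b by simp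
  qed
  then show "\<exists>k. continuous_map Y euclideanreal k \<and> (\<forall>y\<in>T ` topspace X. k y = f y)"
    using continuous_map_compose[OF g \<Phi>(1)] by (intro exI[of _ "\<Phi> \<circ> g"]) auto
qed

section \<open>Assembly of the space and its copy on the candidate type\<close>

theorem theorem3p12:
  fixes X :: "'a topology"
  assumes "tychonoff_space X" and "infinite (topspace X)"
  shows "\<exists>(Y :: 'a candidate_point topology) (T :: 'a \<Rightarrow> 'a candidate_point).
      tychonoff_space Y \<and> pseudocompact_space Y \<and> ascoli_space Y \<and> C_star_embedding X Y T \<and>
      \<not> kR_space Y \<and>
      is_max_card (weight Y) (weight (stone_cech X)) aleph2 \<and>
      closedin Y (T ` topspace X) \<and>
      (omega_bounded_space X \<longrightarrow> omega_bounded_space Y) \<and>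
      (sequentially_compact_space X \<longrightarrow> sequentially_compact_space Y) \<and>
      (totally_countably_compact_space X \<longrightarrow> totally_countably_compact_space Y) \<and>
      (near_sequentially_compact_space X \<longrightarrow> near_sequentially_compact_space Y) \<and>
      (countably_compact_space X \<longrightarrow> countably_compact_space Y)"
proof -
  let ?\<beta> = "stone_cech X" and ?e = "stone_cech_map X"
  obtain \<B> where \<B>: "base_of ?\<beta> \<B>" "weight ?\<beta> = |\<B>|"
    using weight_least(1) by metis
  obtain \<phi> where \<phi>: "\<And>j. continuous_map ?\<beta> (top_of_set {0..1::real}) (\<phi> j)"
    and sep: "\<And>x y. \<lbrakk>x \<in> topspace ?\<beta>; y \<in> topspace ?\<beta>; x \<noteq> y\<rbrakk> \<Longrightarrow> \<exists>j\<in>\<B> \<times> \<B>. \<phi> j x \<noteq> \<phi> j y"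
    by (rule base_separating_functions[OF completely_regular_space_stone_cech[of X]
          Hausdorff_space_stone_cech \<B>(1)], rule that)
  obtain L1 where L1: "L1 \<subseteq> Field aleph2" "uncountable L1" "|L1| <o |Field aleph2|"
    by (rule ex_intermediate_subset_aleph2)
  \<comment> \<open>The left summand carries the separating functions and the right summand is
    \<open>L\<close>; \<open>\<B>\<close> has the size of the weight of the
    compactification.\<close>
  define I where "I = (\<B> \<times> \<B>) <+> Field aleph2"
  define G where "G b = (\<lambda>i\<in>I. case i of Inl j \<Rightarrow> \<phi> j b | Inr _ \<Rightarrow> 1)" for b
  have G: "embedding_map ?\<beta> (unit_cube I) G"
  proof (rule continuous_imp_embedding_map[OF _ compact_space_stone_cech Hausdorff_space_unit_cube])
    show "continuous_map ?\<beta> (unit_cube I) G"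
    proof (rule continuous_map_into_unit_cube)
      fix i assume "i \<in> I"
      then show "continuous_map ?\<beta> (top_of_set {0..1}) (\<lambda>b. G b i)"
        using \<phi> by (cases i) (auto simp: G_def continuous_map_in_subtopology)
    qed (simp add: G_def)
    show "inj_on G (topspace ?\<beta>)"
    proof (rule inj_onI, rule ccontr)
      fix x y assume xy: "x \<in> topspace ?\<beta>" "y \<in> topspace ?\<beta>" "G x = G y" "x \<noteq> y"
      obtain j where j: "j \<in> \<B> \<times> \<B>" "\<phi> j x \<noteq> \<phi> j y" using sep[OF xy(1,2,4)] by blast
      have "Inl j \<in> I" using j(1) by (auto simp: I_def)
      then show False using fun_cong[OF xy(3), of "Inl j"] j(2) by (simp add: G_def)
    qed
  qed
  have emb_cube: "embedding_map X (unit_cube I) (G \<circ> ?e)"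
    by (rule embedding_map_compose[OF embedding_map_stone_cech_map[OF assms(1)] G])
  define E where "E = (G \<circ> ?e) ` topspace X"
  have Esub: "E \<subseteq> topspace (unit_cube I)"
    using emb_cube unfolding E_def embedding_map_def
    by (auto dest!: homeomorphic_imp_surjective_map)
  have iso: "|Inr ` A :: ('b + nat set set) set| =o |A|" for A
    by (rule ordIso_symmetric[OF card_of_ordIsoI[OF inj_on_imp_bij_betw]]) simp
  interpret Z: sigma_extension I "Inr ` Field aleph2" "Inr ` L1" E
  proof
    show "Inr ` Field aleph2 \<subseteq> I" by (auto simp: I_def)
    show "Inr ` L1 \<subseteq> Inr ` Field aleph2" using L1(1) by blast
    show "uncountable (Inr ` L1)" using L1(2) countable_image_inj_eq[of Inr L1] by simp
    show "|Inr ` L1| <o |Inr ` Field aleph2|"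
      by (rule ordIso_ordLess_trans[OF iso ordLess_ordIso_trans[OF L1(3) ordIso_symmetric[OF iso]]])
    show "E \<subseteq> topspace (unit_cube I)" by (rule Esub)
    show "E \<noteq> {}" 
      using infinite_imp_nonempty[OF assms(2)] by (simp only: E_def image_is_empty not_False_eq_True)
    show "q l = 1" if "q \<in> E" "l \<in> Inr ` Field aleph2" for q l
      using that by (auto simp: E_def G_def I_def)
  qed
  have emb_Z: "embedding_map X Z.Z (G \<circ> ?e)"
    unfolding Z.Z_def embedding_map_in_subtopology using emb_cube E_def by blast
  have inf_field: "infinite (Field aleph2)"
    using L1(1,2) uncountable_infinite infinite_super by blast
  \<comment> \<open>Reduces the weight claim to showing that the weight of \<open>Y\<close> equals
    the cardinality of \<open>I\<close>; applied to \<open>|I|\<close> itself, it also bounds the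
    number of coordinates.\<close>
  note max = is_max_card_square_sum[OF _ Card_order_aleph2 inf_field,
      where A = \<B>, folded I_def \<B>(2)]
  have infa: "infinite (UNIV :: 'a set)" using assms(2) infinite_super[OF subset_UNIV] by blast
  have "weight ?\<beta> \<le>o |UNIV :: 'a set set|"
    using ex_small_base_stone_cech[of X] weight_least(2) ordLeq_transitive by blast
  moreover have "|UNIV :: 'a set set| \<le>o |UNIV :: 'a set set set|"
    by (rule ordLess_imp_ordLeq[OF card_of_Pow[of "UNIV :: 'a set set", unfolded Pow_UNIV]])
  ultimately have "weight ?\<beta> \<le>o |UNIV :: 'a set set set|" by (rule ordLeq_transitive)
  then have I_le: "|I| \<le>o |UNIV :: 'a set set set|"
    by (rule is_max_card_le[OF max[OF card_of_refl] _ aleph2_le[OF infa]])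
  have "infinite (UNIV :: 'a set set set)"
    using infa by (simp add: Finite_Set.finite_set)
  note inject = real_functions_inject[OF I_le this]
  \<comment> \<open>With at most \<open>|UNIV :: 'a set set set|\<close> coordinates, real functions
    on \<open>I\<close> are encoded by sets over \<open>'a set set\<close>, that is, by candidate
    points.\<close>
  obtain h :: "_ \<Rightarrow> 'a candidate_point" where "inj_on h (extensional I :: (_ \<Rightarrow> real) set)"
    by (rule inject, rule that)
  moreover have "topspace Z.Z \<subseteq> extensional I"
    using Z.topspace_Z_subset by (auto simp: topspace_unit_cube PiE_iff)
  ultimately have "inj_on h (topspace Z.Z)" by (rule inj_on_subset)
  then obtain Y g where hom: "homeomorphic_maps Z.Z Y h g" by (rule homeomorphic_copy)
  then have homs: "homeomorphic_maps Y Z.Z g h" by (rule homeomorphic_maps_sym[THEN iffD1])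
  have hm: "homeomorphic_map Z.Z Y h" using hom homeomorphic_map_maps by blast
  have hs: "Z.Z homeomorphic_space Y" by (rule homeomorphic_maps_imp_homeomorphic_space[OF hom])
  define T where "T = h \<circ> (G \<circ> ?e)"
  have emb_Y: "embedding_map X Y T"
    unfolding T_def by (rule embedding_map_compose[OF emb_Z homeomorphic_map_imp_embedding_map[OF hm]])
  have TE: "T ` topspace X = h ` E" by (simp add: T_def E_def image_comp comp_assoc)
  interpret Y: sequential_core Y "h ` sigma_product I"
    by (rule sequential_core_homeomorphic[OF hom Z.sequential_core_axioms])
  have tych: "tychonoff_space Y"
    using Z.tychonoff_Z homeomorphic_completely_regular_space[OF hs] homeomorphic_Hausdorff_space[OF hs]
    by (simp add: tychonoff_space_def)
  then have haus: "Hausdorff_space Y" by (simp add: tychonoff_space_def)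
  have cover: "topspace Y = h ` sigma_product I \<union> T ` topspace X"
    using homeomorphic_imp_surjective_map[OF hm] by (simp add: Z.topspace_Z image_Un TE)
  have contT: "continuous_map X Y T"
    using homeomorphic_imp_continuous_map[OF emb_Y[unfolded embedding_map_def]]
    by (simp add: continuous_map_in_subtopology)
  have "C_star_embedding X Y T"
  proof (rule C_star_embedding_via_cube[OF emb_Y G])
    show "continuous_map Y (unit_cube I) g"
      using homs unfolding homeomorphic_maps_def Z.Z_def continuous_map_in_subtopology by blast
    fix x assume "x \<in> topspace X"
    then have "(G \<circ> ?e) x \<in> E" unfolding E_def by (rule imageI)
    then have "(G \<circ> ?e) x \<in> topspace Z.Z" unfolding Z.topspace_Z by blast
    then have "g (h ((G \<circ> ?e) x)) = (G \<circ> ?e) x" using hom by (simp add: homeomorphic_maps_def)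
    then show "g (T x) = G (?e x)" by (simp add: T_def)
  qed
  moreover have "\<not> kR_space Y" using kR_space_homeomorphic[OF hom] Z.not_kR by blast
  moreover have "is_max_card (weight Y) (weight ?\<beta>) aleph2"
  proof (rule max)
    \<comment> \<open>Bases are carried in both directions: a small base of \<open>Z.Z\<close>
      bounds the weight from above, and a least base of \<open>Y\<close>, moved back to
      \<open>Z.Z\<close>, has at least \<open>|I|\<close> members.\<close>
    obtain \<C> where \<C>: "base_of Z.Z \<C>" "|\<C>| \<le>o |I|" using Z.ex_base_le by blast
    have "weight Y \<le>o |(`) h ` \<C>|" by (rule weight_least(2)[OF base_of_homeomorphic[OF hom \<C>(1)]])
    also have "|(`) h ` \<C>| \<le>o |\<C>|" by (rule card_of_image)
    also note \<C>(2)
    finally have upper: "weight Y \<le>o |I|" .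
    obtain \<D> where \<D>: "base_of Y \<D>" "weight Y = |\<D>|" using weight_least(1) by metis
    have "|I| \<le>o |(`) g ` \<D>|" by (rule Z.base_ge[OF base_of_homeomorphic[OF homs \<D>(1)]])
    also have "|(`) g ` \<D>| \<le>o |\<D>|" by (rule card_of_image)
    finally show "weight Y =o |I|" using upper unfolding \<D>(2) ordIso_iff_ordLeq by blast
  qed
  moreover have "closedin Y (T ` topspace X)"
    using homeomorphic_map_closedness[OF hm, of E] Z.closedin_E closedin_subset[OF Z.closedin_E]
    unfolding TE by blast
  ultimately show ?thesis
    using tych Y.pseudocompact Y.ascoli Y.near_sequentially_compact
      Y.omega_bounded[OF cover contT haus] Y.sequentially_compact[OF cover contT haus]
      Y.totally_countably_compact[OF cover contT haus] Y.countably_compact[OF cover contT haus]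
    by (intro exI[of _ Y] exI[of _ T]) simp
qed

end
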